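(* Let $X,Y$ be compact Hausdorff spaces, let $(A(X),\|\cdot\|_{A(X)})$ be a regular Banach function algebra on $X$ having property (P), let $A(Y)$ be a Banach function algebra on $Y$, and let $T,S:A(X)\to A(Y)$ be complex-linear jointly separating bijections. Then $X$ and $Y$ are homeomorphic and $T,S$ are jointly biseparating, that is, $T^{-1},S^{-1}:A(Y)\to A(X)$ are also jointly separating.
   Context: $C(X)$ is the algebra of continuous complex-valued functions on $X$. A Banach function algebra on $X$ is a complex subalgebra $A(X)$ of $C(X)$ that contains the constants, separates the points of $X$, and is a Banach algebra under some norm $\|\cdot\|_{A(X)}$. It is regular if for every closed subset $K$ of its maximal ideal space and every $\varphi\notin K$ in the maximal ideal space there is $f\in A(X)$ whose Gelfand transform satisfies $\widehat f(\varphi)=1$ and $\widehat f=0$ on $K$. Property (P) for $(A(X),\|\cdot\|_{A(X)})$: for each $f\in A(X)$ and $x\in X$ with $f(x)=0$ there is a sequence $\{f_n\}$ in $A(X)$ such that each $f_n$ vanishes on a neighborhood of $x$ and $\|f_n-f\|_{A(X)}\to0$. With $\mathrm{coz}(f)=\{x:f(x)\ne0\}$, two linear maps $T,S$ between spaces of functions (with common domain and common codomain) are jointly separating if $\mathrm{coz}(Tf)\cap\mathrm{coz}(Sg)=\emptyset$ for all $f,g$ in the domain with $\mathrm{coz}(f)\cap\mathrm{coz}(g)=\emptyset$. *)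

theory Defs
  imports "HOL-Analysis.Analysis"
begin

text \<open>
  A compact Hausdorff space is a type \<open>'a :: t2_space\<close> with \<open>compact (UNIV :: 'a set)\<close>.
  An algebra of functions is a set of functions on that type, with pointwise operations.
\<close>

definition function_algebra :: "('a::topological_space \<Rightarrow> complex) set \<Rightarrow> bool" where
  "function_algebra A \<longleftrightarrow>
     (\<forall>f\<in>A. continuous_on UNIV f) \<and>
     (\<forall>c. (\<lambda>x. c) \<in> A) \<and>
     (\<forall>f\<in>A. \<forall>g\<in>A. (\<lambda>x. f x + g x) \<in> A) \<and>
     (\<forall>c. \<forall>f\<in>A. (\<lambda>x. c * f x) \<in> A) \<and>
     (\<forall>f\<in>A. \<forall>g\<in>A. (\<lambda>x. f x * g x) \<in> A) \<and>
     (\<forall>x y. x \<noteq> y \<longrightarrow> (\<exists>f\<in>A. f x \<noteq> f y))"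

text \<open>
  The values of \<open>N\<close> outside \<open>A\<close> are irrelevant. The normalization \<open>N 1 = 1\<close> is not required.
\<close>

definition algebra_norm :: "('a \<Rightarrow> complex) set \<Rightarrow> (('a \<Rightarrow> complex) \<Rightarrow> real) \<Rightarrow> bool" where
  "algebra_norm A N \<longleftrightarrow>
     (\<forall>f\<in>A. 0 \<le> N f) \<and>
     (\<forall>f\<in>A. N f = 0 \<longleftrightarrow> f = (\<lambda>x. 0)) \<and>
     (\<forall>f\<in>A. \<forall>g\<in>A. N (\<lambda>x. f x + g x) \<le> N f + N g) \<and>
     (\<forall>c. \<forall>f\<in>A. N (\<lambda>x. c * f x) = cmod c * N f) \<and>
     (\<forall>f\<in>A. \<forall>g\<in>A. N (\<lambda>x. f x * g x) \<le> N f * N g)"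

definition complete_norm :: "('a \<Rightarrow> complex) set \<Rightarrow> (('a \<Rightarrow> complex) \<Rightarrow> real) \<Rightarrow> bool" where
  "complete_norm A N \<longleftrightarrow>
     (\<forall>F :: nat \<Rightarrow> 'a \<Rightarrow> complex.
        (\<forall>n. F n \<in> A) \<and>
        (\<forall>\<epsilon>>0. \<exists>n0. \<forall>m\<ge>n0. \<forall>n\<ge>n0. N (\<lambda>x. F m x - F n x) < \<epsilon>) \<longrightarrow>
        (\<exists>f\<in>A. (\<lambda>n. N (\<lambda>x. F n x - f x)) \<longlonglongrightarrow> 0))"

definition banach_function_algebra ::
    "('a::topological_space \<Rightarrow> complex) set \<Rightarrow> (('a \<Rightarrow> complex) \<Rightarrow> real) \<Rightarrow> bool" where
  "banach_function_algebra A N \<longleftrightarrow>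
     function_algebra A \<and> algebra_norm A N \<and> complete_norm A N"

text \<open>
  The maximal ideal space is the set of characters (nonzero complex algebra homomorphisms
  \<open>A \<rightarrow> \<complex>\<close>, made unique as HOL functions by extensionality) with the Gelfand topology, which is
  the topology of pointwise convergence on \<open>A\<close>.
\<close>

definition characters :: "('a \<Rightarrow> complex) set \<Rightarrow> (('a \<Rightarrow> complex) \<Rightarrow> complex) set" where
  "characters A =
     {\<phi> \<in> extensional A.
        (\<exists>f\<in>A. \<phi> f \<noteq> 0) \<and>
        (\<forall>f\<in>A. \<forall>g\<in>A. \<phi> (\<lambda>x. f x + g x) = \<phi> f + \<phi> g) \<and>
        (\<forall>c. \<forall>f\<in>A. \<phi> (\<lambda>x. c * f x) = c * \<phi> f) \<and>
        (\<forall>f\<in>A. \<forall>g\<in>A. \<phi> (\<lambda>x. f x * g x) = \<phi> f * \<phi> g)}"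

definition maximal_ideal_space ::
    "('a \<Rightarrow> complex) set \<Rightarrow> (('a \<Rightarrow> complex) \<Rightarrow> complex) topology" where
  "maximal_ideal_space A = subtopology (product_topology (\<lambda>_. euclidean) A) (characters A)"

definition gelfand_transform ::
    "('a \<Rightarrow> complex) \<Rightarrow> (('a \<Rightarrow> complex) \<Rightarrow> complex) \<Rightarrow> complex" where
  "gelfand_transform f \<phi> = \<phi> f"

definition regular_algebra :: "('a \<Rightarrow> complex) set \<Rightarrow> bool" where
  "regular_algebra A \<longleftrightarrow>
     (\<forall>K \<phi>. closedin (maximal_ideal_space A) K \<and>
        \<phi> \<in> topspace (maximal_ideal_space A) \<and> \<phi> \<notin> K \<longrightarrow>
        (\<exists>f\<in>A. gelfand_transform f \<phi> = 1 \<and> (\<forall>\<psi>\<in>K. gelfand_transform f \<psi> = 0)))"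

definition property_P ::
    "('a::topological_space \<Rightarrow> complex) set \<Rightarrow> (('a \<Rightarrow> complex) \<Rightarrow> real) \<Rightarrow> bool" where
  "property_P A N \<longleftrightarrow>
     (\<forall>f\<in>A. \<forall>x. f x = 0 \<longrightarrow>
        (\<exists>F :: nat \<Rightarrow> 'a \<Rightarrow> complex.
           (\<forall>n. F n \<in> A \<and> (\<exists>U. open U \<and> x \<in> U \<and> (\<forall>y\<in>U. F n y = 0))) \<and>
           (\<lambda>n. N (\<lambda>y. F n y - f y)) \<longlonglongrightarrow> 0))"

definition coz :: "('a \<Rightarrow> complex) \<Rightarrow> 'a set" where
  "coz f = {x. f x \<noteq> 0}"

definition complex_linear_map ::
    "('a \<Rightarrow> complex) set \<Rightarrow> ('b \<Rightarrow> complex) set \<Rightarrow> (('a \<Rightarrow> complex) \<Rightarrow> ('b \<Rightarrow> complex)) \<Rightarrow> bool" where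
  "complex_linear_map A B T \<longleftrightarrow>
     (\<forall>f\<in>A. T f \<in> B) \<and>
     (\<forall>f\<in>A. \<forall>g\<in>A. T (\<lambda>x. f x + g x) = (\<lambda>y. T f y + T g y)) \<and>
     (\<forall>c. \<forall>f\<in>A. T (\<lambda>x. c * f x) = (\<lambda>y. c * T f y))"

definition jointly_separating ::
    "('a \<Rightarrow> complex) set \<Rightarrow> ('b \<Rightarrow> complex) set \<Rightarrow>
     (('a \<Rightarrow> complex) \<Rightarrow> ('b \<Rightarrow> complex)) \<Rightarrow> (('a \<Rightarrow> complex) \<Rightarrow> ('b \<Rightarrow> complex)) \<Rightarrow> bool" where
  "jointly_separating A B T S \<longleftrightarrow>
     complex_linear_map A B T \<and> complex_linear_map A B S \<and>
     (\<forall>f\<in>A. \<forall>g\<in>A. coz f \<inter> coz g = {} \<longrightarrow> coz (T f) \<inter> coz (S g) = {})"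

end

(* For y in Y, disjointness makes the functionals f -> T f y and f -> S f y share a one-point
   support h(y), and h : Y -> X is continuous and onto. Call y regular if T f y depends only on
   f(h(y)). If h of the regular points missed an open set, that set would have no isolated points,
   and property (P) would allow a gliding hump whose image under T is unbounded; so h maps the
   closed set of regular points onto X. Restriction to the regular points then identifies B with A
   as an algebra, so every y in Y gives a character of A. Regularity forces every character to be an
   evaluation, and since B separates points, y is regular. Hence T f = T 1 * (f o h) and
   S f = S 1 * (f o h) with the same h, which is a homeomorphism.

   The supports rest on the Gelfand theorem that an ideal without common zeros contains 1. The
   Gelfand-Mazur step applies a discrete maximum principle to the quotient norm of the resolvent
   instead of Liouville's theorem, which avoids the Hahn-Banach theorem. *)

theory Submission
  imports Defs
begin

section \<open>Gelfand theory\<close>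

text \<open>No continuity of \<open>T\<close> is assumed. Locality gives \<open>T f y = 0\<close>
  only when \<open>f\<close> vanishes near \<open>h y\<close>. Property (P) makes such functions
  norm dense among those vanishing at \<open>h y\<close>, so a norm continuous functional would be
  regular at once. The gliding hump replaces this continuity, but it yields only enough regular
  points to cover \<open>X\<close>; the remaining points of \<open>Y\<close> need the algebraic
  argument. There, with \<open>T u = 1\<close>, the function \<open>T (f * u)\<close> equals
  \<open>f \<circ> h\<close> at regular points. Values at regular points determine the preimage
  under \<open>T\<close>, so products in \<open>B\<close> are matched by products in
  \<open>A\<close>, and multiplicativity spreads to every point of \<open>Y\<close>. The two maps
  interact only in the construction of \<open>h\<close>: every support point for \<open>T\<close>
  equals every support point for \<open>S\<close>, so both supports are the same single point. The
  rest is proved for one map with a given \<open>h\<close> and instantiated twice.\<close>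

text \<open>The mean of \<open>\<bar>z\<bar>\<^sup>2\<close> over the four points exceeds the centre value by \<open>\<rho>\<^sup>2\<close>, which beats the
  error \<open>C * \<rho> ^ 4\<close>; so \<open>u z + e * \<bar>z\<bar>\<^sup>2\<close> has no interior maximum.\<close>

lemma four_point_maximum_principle:
  fixes u :: "complex \<Rightarrow> real"
  assumes cont: "continuous_on UNIV u"
    and lim: "(u \<longlongrightarrow> 0) at_infinity"
    and mean: "\<And>R. \<exists>C. \<forall>z \<rho>. cmod z \<le> R \<longrightarrow> 0 < \<rho> \<longrightarrow> \<rho> \<le> 1 \<longrightarrow>
      4 * u z \<le> u (z + of_real \<rho>) + u (z - of_real \<rho>) +
        u (z + \<i> * of_real \<rho>) + u (z - \<i> * of_real \<rho>) + C * \<rho> ^ 4"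
  shows "u 0 \<le> 0"
proof (rule ccontr)
  assume "\<not> u 0 \<le> 0"
  then have u0: "u 0 > 0" by simp
  have "eventually (\<lambda>z. u z < u 0 / 2) at_infinity"
    using lim u0 by (intro order_tendstoD) auto
  then obtain R0 where R0: "\<And>z. norm z \<ge> R0 \<Longrightarrow> u z < u 0 / 2"
    unfolding eventually_at_infinity by auto
  define R where "R = max R0 1"
  have R: "R \<ge> 1" "\<And>z. cmod z \<ge> R \<Longrightarrow> u z < u 0 / 2" using R0 by (auto simp: R_def)
  \<comment> \<open>The perturbation is then at most \<open>u 0 / 4\<close> on the disc. On its
    boundary \<open>u z < u 0 / 2\<close>, so \<open>v\<close> stays below \<open>v 0 = u 0\<close>
    there and the maximum is interior.\<close>
  define e where "e = u 0 / (4 * R\<^sup>2)"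
  have e: "e > 0" "e * R\<^sup>2 < u 0 / 2" using u0 R(1) by (auto simp: e_def field_simps)
  define v where "v = (\<lambda>z. u z + e * (cmod z)\<^sup>2)"
  have "continuous_on (cball 0 R) v"
    unfolding v_def by (intro continuous_intros continuous_on_subset[OF cont]) auto
  moreover have "cball (0::complex) R \<noteq> {}" using R(1) by auto
  ultimately obtain z where z: "z \<in> cball 0 R" "\<And>w. w \<in> cball 0 R \<Longrightarrow> v w \<le> v z"
    using continuous_attains_sup[of "cball (0::complex) R" v] by auto
  have "v 0 \<le> v z" using z(2) R(1) by auto
  then have vz: "u 0 \<le> v z" by (simp add: v_def)
  have zR: "cmod z < R"
  proof (rule ccontr)
    assume "\<not> ?thesis"
    with z(1) have "cmod z = R" by auto
    with R(2)[of z] e(2) vz show False by (simp add: v_def)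
  qed
  obtain C where C: "\<And>w \<rho>. cmod w \<le> R \<Longrightarrow> 0 < \<rho> \<Longrightarrow> \<rho> \<le> 1 \<Longrightarrow>
      4 * u w \<le> u (w + of_real \<rho>) + u (w - of_real \<rho>) +
        u (w + \<i> * of_real \<rho>) + u (w - \<i> * of_real \<rho>) + C * \<rho> ^ 4"
    using mean[of R] by auto
  define D where "D = max C 1"
  \<comment> \<open>The bound \<open>1\<close> is the range of \<open>mean\<close>,
    \<open>R - cmod z\<close> keeps the four points in the disc, and \<open>e / D\<close> gives
    \<open>D * \<rho> \<le> e\<close>, against \<open>4 * e \<le> D * \<rho>\<^sup>2\<close>
    below.\<close>
  define \<rho> where "\<rho> = Min {1, R - cmod z, e / D}"
  have D: "D \<ge> 1" "D \<ge> C" by (auto simp: D_def)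
  have r: "0 < \<rho>" "\<rho> \<le> 1" "\<rho> \<le> R - cmod z" "\<rho> \<le> e / D"
    using zR e(1) D by (auto simp: \<rho>_def)
  have m: "v w \<le> v z" if "cmod (w - z) = \<rho>" for w
  proof -
    have "cmod w \<le> cmod (w - z) + cmod z" using norm_triangle_ineq[of "w - z" z] by simp
    with that r(3) show ?thesis by (intro z(2)) simp
  qed
  have m4: "v (z + of_real \<rho>) \<le> v z" "v (z - of_real \<rho>) \<le> v z"
    "v (z + \<i> * of_real \<rho>) \<le> v z" "v (z - \<i> * of_real \<rho>) \<le> v z"
    using r(1) by (auto intro!: m simp: norm_mult)
  have sq: "(cmod (z + of_real \<rho>))\<^sup>2 + (cmod (z - of_real \<rho>))\<^sup>2
      + (cmod (z + \<i> * of_real \<rho>))\<^sup>2 + (cmod (z - \<i> * of_real \<rho>))\<^sup>2 = 4 * (cmod z)\<^sup>2 + 4 * \<rho>\<^sup>2"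
    by (simp only: cmod_power2) (simp add: power2_eq_square algebra_simps)
  have "e * ((cmod (z + of_real \<rho>))\<^sup>2 + (cmod (z - of_real \<rho>))\<^sup>2
      + (cmod (z + \<i> * of_real \<rho>))\<^sup>2 + (cmod (z - \<i> * of_real \<rho>))\<^sup>2) = e * (4 * (cmod z)\<^sup>2 + 4 * \<rho>\<^sup>2)"
    by (simp only: sq)
  with m4 C[of z \<rho>] r zR have "4 * e * \<rho>\<^sup>2 \<le> C * \<rho> ^ 4"
    by (simp add: v_def algebra_simps)
  also have "\<dots> \<le> D * \<rho> ^ 4" using D r by (intro mult_right_mono) auto
  finally have "4 * e * \<rho>\<^sup>2 \<le> (D * \<rho>\<^sup>2) * \<rho>\<^sup>2" by (simp add: power2_eq_square power4_eq_xxxx algebra_simps)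
  then have "4 * e \<le> D * \<rho>\<^sup>2" using r(1) by (simp add: mult_le_cancel_right)
  also have "\<dots> \<le> D * \<rho>" using D r by (intro mult_left_mono) (auto simp: power2_eq_square mult_le_one)
  also have "\<dots> \<le> e" using r D by (simp add: field_simps)
  finally show False using e(1) by simp
qed

section \<open>Norm estimates, series and invertibility in a Banach function algebra\<close>

locale compact_banach_function_algebra =
  fixes A :: "('a::t2_space \<Rightarrow> complex) set" and N :: "('a \<Rightarrow> complex) \<Rightarrow> real"
  assumes compact_UNIV: "compact (UNIV :: 'a set)"
    and banach: "banach_function_algebra A N"
begin

lemma in_A_continuous: "f \<in> A \<Longrightarrow> continuous_on UNIV f"
  and in_A_const: "(\<lambda>x. c) \<in> A"
  and in_A_add: "f \<in> A \<Longrightarrow> g \<in> A \<Longrightarrow> (\<lambda>x. f x + g x) \<in> A"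
  and in_A_cmult: "f \<in> A \<Longrightarrow> (\<lambda>x. c * f x) \<in> A"
  and in_A_mult: "f \<in> A \<Longrightarrow> g \<in> A \<Longrightarrow> (\<lambda>x. f x * g x) \<in> A"
  and separates_points: "x \<noteq> y \<Longrightarrow> \<exists>f\<in>A. f x \<noteq> f y"
  using banach unfolding banach_function_algebra_def function_algebra_def by auto

lemma in_A_uminus: "f \<in> A \<Longrightarrow> (\<lambda>x. - f x) \<in> A"
  using in_A_cmult[of f "-1"] by simp

lemma in_A_diff: "f \<in> A \<Longrightarrow> g \<in> A \<Longrightarrow> (\<lambda>x. f x - g x) \<in> A"
  using in_A_add[OF _ in_A_uminus, of f g] by simp

lemma in_A_power: "f \<in> A \<Longrightarrow> (\<lambda>x. f x ^ n) \<in> A"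
  by (induction n) (simp_all add: in_A_const in_A_mult)

lemma in_A_sum: "(\<And>i. i \<in> I \<Longrightarrow> F i \<in> A) \<Longrightarrow> (\<lambda>x. \<Sum>i\<in>I. F i x) \<in> A"
  by (induction I rule: infinite_finite_induct) (simp_all add: in_A_const in_A_add)

lemmas in_A_intros = in_A_const in_A_add in_A_mult in_A_uminus in_A_diff in_A_power in_A_sum

lemma norm_nonneg: "f \<in> A \<Longrightarrow> 0 \<le> N f"
  and norm_eq_0_iff: "f \<in> A \<Longrightarrow> N f = 0 \<longleftrightarrow> f = (\<lambda>x. 0)"
  and norm_add: "f \<in> A \<Longrightarrow> g \<in> A \<Longrightarrow> N (\<lambda>x. f x + g x) \<le> N f + N g"
  and norm_cmult: "f \<in> A \<Longrightarrow> N (\<lambda>x. c * f x) = cmod c * N f"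
  and norm_mult_le: "f \<in> A \<Longrightarrow> g \<in> A \<Longrightarrow> N (\<lambda>x. f x * g x) \<le> N f * N g"
  using banach unfolding banach_function_algebra_def algebra_norm_def by (auto intro: in_A_intros)

lemma algebra_norm_zero: "N (\<lambda>x. 0) = 0"
  using norm_eq_0_iff[OF in_A_const[of 0]] by simp

lemma norm_uminus: "f \<in> A \<Longrightarrow> N (\<lambda>x. - f x) = N f"
  using norm_cmult[of f "-1"] by simp

lemma norm_commute: "f \<in> A \<Longrightarrow> g \<in> A \<Longrightarrow> N (\<lambda>x. f x - g x) = N (\<lambda>x. g x - f x)"
  using norm_uminus[OF in_A_diff, of f g] by simp

lemma algebra_norm_sum: "(\<And>i. i \<in> I \<Longrightarrow> F i \<in> A) \<Longrightarrow> N (\<lambda>x. \<Sum>i\<in>I. F i x) \<le> (\<Sum>i\<in>I. N (F i))"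
proof (induction I rule: infinite_finite_induct)
  case (insert i I)
  then have "N (\<lambda>x. F i x + (\<Sum>i\<in>I. F i x)) \<le> N (F i) + N (\<lambda>x. \<Sum>i\<in>I. F i x)"
    by (intro norm_add) (auto intro: in_A_intros)
  with insert show ?case by fastforce
qed (auto simp: algebra_norm_zero)

text \<open>The factor \<open>N (\<lambda>x. 1)\<close> accounts for \<open>n = 0\<close>, since
  \<open>N\<close> need not be normalized.\<close>

lemma algebra_norm_power: "f \<in> A \<Longrightarrow> N (\<lambda>x. f x ^ n) \<le> N (\<lambda>x. 1) * N f ^ n"
proof (induction n)
  case (Suc n)
  have "N (\<lambda>x. f x * f x ^ n) \<le> N f * N (\<lambda>x. f x ^ n)"
    using Suc.prems by (intro norm_mult_le) (auto intro: in_A_intros)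
  also have "\<dots> \<le> N f * (N (\<lambda>x. 1) * N f ^ n)"
    using Suc by (intro mult_left_mono norm_nonneg) auto
  finally show ?case by (simp add: mult_ac)
qed simp

lemma complete:
  assumes "\<And>n. F n \<in> A"
    and "\<And>e. e > 0 \<Longrightarrow> \<exists>n0. \<forall>m\<ge>n0. \<forall>n\<ge>n0. N (\<lambda>x. F m x - F n x) < e"
  shows "\<exists>f\<in>A. (\<lambda>n. N (\<lambda>x. F n x - f x)) \<longlonglongrightarrow> 0"
  using banach assms unfolding banach_function_algebra_def complete_norm_def by blast

lemma absolutely_convergent_series:
  assumes F: "\<And>k. F k \<in> A" and s: "summable (\<lambda>k. N (F k))"
  shows "\<exists>f\<in>A. (\<lambda>n. N (\<lambda>x. (\<Sum>k<n. F k x) - f x)) \<longlonglongrightarrow> 0"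
proof (rule complete)
  show "(\<lambda>x. \<Sum>k<n. F k x) \<in> A" for n using F by (auto intro: in_A_intros)
next
  fix e :: real assume e: "e > 0"
  have block: "N (\<lambda>x. (\<Sum>k<n. F k x) - (\<Sum>k<m. F k x)) \<le> (\<Sum>k=m..<n. N (F k))" if "m \<le> n" for m n
  proof -
    have "(\<lambda>x. (\<Sum>k<n. F k x) - (\<Sum>k<m. F k x)) = (\<lambda>x. \<Sum>k=m..<n. F k x)"
      using that by (simp add: fun_eq_iff lessThan_atLeast0 sum_diff_nat_ivl)
    then show ?thesis using algebra_norm_sum[of "{m..<n}" F] F by simp
  qed
  from s e obtain n0 where n0: "\<And>m n. m \<ge> n0 \<Longrightarrow> norm (\<Sum>k=m..<n. N (F k)) < e"
    unfolding summable_Cauchy by blast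
  have "N (\<lambda>x. (\<Sum>k<m. F k x) - (\<Sum>k<n. F k x)) < e" if "m \<ge> n0" "n \<ge> n0" for m n
  proof (cases "m \<le> n")
    case True
    have "N (\<lambda>x. (\<Sum>k<m. F k x) - (\<Sum>k<n. F k x)) = N (\<lambda>x. (\<Sum>k<n. F k x) - (\<Sum>k<m. F k x))"
      using F by (intro norm_commute) (auto intro: in_A_intros)
    also have "\<dots> \<le> (\<Sum>k=m..<n. N (F k))" using True by (rule block)
    also have "\<dots> < e" using n0[OF that(1), of n] by (auto intro: in_A_intros)
    finally show ?thesis .
  next
    case False
    then have "N (\<lambda>x. (\<Sum>k<m. F k x) - (\<Sum>k<n. F k x)) \<le> (\<Sum>k=n..<m. N (F k))"
      by (intro block) (auto intro: in_A_intros)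
    also have "\<dots> < e" using n0[OF that(2), of m] by (auto intro: in_A_intros)
    finally show ?thesis .
  qed
  then show "\<exists>n0. \<forall>m\<ge>n0. \<forall>n\<ge>n0. N (\<lambda>x. (\<Sum>k<m. F k x) - (\<Sum>k<n. F k x)) < e" by blast
qed

lemma norm_limit_unique:
  assumes "\<And>n. F n \<in> A" "f \<in> A" "g \<in> A"
    and "(\<lambda>n. N (\<lambda>x. F n x - f x)) \<longlonglongrightarrow> 0" "(\<lambda>n. N (\<lambda>x. F n x - g x)) \<longlonglongrightarrow> 0"
  shows "f = g"
proof -
  have "N (\<lambda>x. f x - g x) \<le> N (\<lambda>x. F n x - f x) + N (\<lambda>x. F n x - g x)" for n
  proof -
    have "N (\<lambda>x. (f x - F n x) + (F n x - g x)) \<le> N (\<lambda>x. f x - F n x) + N (\<lambda>x. F n x - g x)"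
      using assms by (intro norm_add) (auto intro: in_A_intros)
    then show ?thesis using assms norm_commute[of f "F n"] by simp
  qed
  moreover have "(\<lambda>n. N (\<lambda>x. F n x - f x) + N (\<lambda>x. F n x - g x)) \<longlonglongrightarrow> 0"
    using tendsto_add[OF assms(4,5)] by simp
  ultimately have "N (\<lambda>x. f x - g x) \<le> 0"
    by (intro LIMSEQ_le_const) (auto intro: in_A_intros)
  then have "N (\<lambda>x. f x - g x) = 0" using norm_nonneg[OF in_A_diff[OF assms(2,3)]] by simp
  then have "(\<lambda>x. f x - g x) = (\<lambda>x. 0)" using norm_eq_0_iff[of "\<lambda>x. f x - g x"] assms by (auto intro: in_A_intros)
  then show ?thesis by (simp add: fun_eq_iff)
qed

lemma norm_tendsto_0:
  assumes "\<And>n. F n \<in> A" "\<And>n. N (F n) \<le> b n" "b \<longlonglongrightarrow> 0"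
  shows "(\<lambda>n. N (F n)) \<longlonglongrightarrow> 0"
  using norm_nonneg[OF assms(1)] assms(2)
  by (intro tendsto_sandwich[OF _ _ tendsto_const assms(3)] always_eventually) (auto intro: in_A_intros)

text \<open>Neumann series: with \<open>g\<close> the sum of the powers of \<open>f\<close>, the
  functions \<open>1 - f x ^ n\<close> converge in norm both to \<open>1\<close> and to
  \<open>(1 - f x) * g x\<close>. The limits are compared in norm because pointwise convergence is
  only available from \<open>norm_evaluation_le\<close>, which rests on this lemma.\<close>

lemma one_minus_invertible:
  assumes f: "f \<in> A" and "N f < 1"
  shows "\<exists>g\<in>A. \<forall>x. (1 - f x) * g x = 1"
proof -
  have lim0: "(\<lambda>n. N (\<lambda>x. 1) * N f ^ n) \<longlonglongrightarrow> 0"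
    using assms norm_nonneg[OF f] by (intro tendsto_mult_right_zero LIMSEQ_realpow_zero) (auto intro: in_A_intros)
  have "summable (\<lambda>k. N (\<lambda>x. 1) * N f ^ k)"
    using assms norm_nonneg[OF f] by (intro summable_mult summable_geometric) (auto intro: in_A_intros)
  then have "summable (\<lambda>k. N (\<lambda>x. f x ^ k))"
    by (rule summable_comparison_test'[where N=0])
      (simp add: algebra_norm_power[OF f] abs_of_nonneg[OF norm_nonneg[OF in_A_power[OF f]]])
  from absolutely_convergent_series[OF in_A_power[OF f] this]
  obtain g where g: "g \<in> A" and lim: "(\<lambda>n. N (\<lambda>x. (\<Sum>k<n. f x ^ k) - g x)) \<longlonglongrightarrow> 0" by blast
  have F: "1 - f x ^ n = (1 - f x) * (\<Sum>k<n. f x ^ k)" for n x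
    by (rule one_diff_power_eq)
  have sA: "(\<lambda>x. \<Sum>k<n. f x ^ k) \<in> A" for n using f by (intro in_A_sum in_A_power)
  have "(\<lambda>x. 1) = (\<lambda>x. (1 - f x) * g x)"
  proof (rule norm_limit_unique[where F = "\<lambda>n x. 1 - f x ^ n"])
    show "(\<lambda>x. 1 - f x ^ n) \<in> A" for n using f by (intro in_A_diff in_A_power in_A_const)
    show "(\<lambda>n. N (\<lambda>x. 1 - f x ^ n - 1)) \<longlonglongrightarrow> 0"
    proof (rule norm_tendsto_0[OF _ _ lim0])
      show "(\<lambda>x. 1 - f x ^ n - 1) \<in> A" for n using f by (intro in_A_diff in_A_power in_A_const)
      show "N (\<lambda>x. 1 - f x ^ n - 1) \<le> N (\<lambda>x. 1) * N f ^ n" for n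
        using norm_uminus[OF in_A_power[OF f]] algebra_norm_power[OF f, of n] by simp
    qed
    show "(\<lambda>n. N (\<lambda>x. 1 - f x ^ n - (1 - f x) * g x)) \<longlonglongrightarrow> 0"
    proof (rule norm_tendsto_0)
      show "(\<lambda>x. 1 - f x ^ n - (1 - f x) * g x) \<in> A" for n
        using f g by (intro in_A_diff in_A_mult in_A_power in_A_const)
      have "(\<lambda>x. 1 - f x ^ n - (1 - f x) * g x) = (\<lambda>x. (1 - f x) * ((\<Sum>k<n. f x ^ k) - g x))" for n
        by (simp only: F right_diff_distrib)
      then show "N (\<lambda>x. 1 - f x ^ n - (1 - f x) * g x)
          \<le> N (\<lambda>x. 1 - f x) * N (\<lambda>x. (\<Sum>k<n. f x ^ k) - g x)" for n
        using f g sA by (simp only: norm_mult_le in_A_diff in_A_const)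
      show "(\<lambda>n. N (\<lambda>x. 1 - f x) * N (\<lambda>x. (\<Sum>k<n. f x ^ k) - g x)) \<longlonglongrightarrow> 0"
        by (intro tendsto_mult_right_zero lim)
    qed
    show "(\<lambda>x. 1) \<in> A" by (rule in_A_const)
    show "(\<lambda>x. (1 - f x) * g x) \<in> A" using f g by (intro in_A_mult in_A_diff in_A_const)
  qed
  then show ?thesis using g by (auto simp: fun_eq_iff)
qed

text \<open>Otherwise \<open>f / f x\<close> has norm below \<open>1\<close>, and the invertible
  function \<open>1 - f / f x\<close> would vanish at \<open>x\<close>.\<close>

lemma norm_evaluation_le:
  assumes f: "f \<in> A" shows "cmod (f x) \<le> N f"
proof (rule ccontr)
  assume *: "\<not> ?thesis"
  then have nz: "f x \<noteq> 0" using norm_nonneg[OF f] by (auto intro: in_A_intros)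
  have "N (\<lambda>y. inverse (f x) * f y) = N f / cmod (f x)"
    unfolding norm_cmult[OF f] by (simp add: norm_inverse divide_inverse mult.commute)
  also have "\<dots> < 1" using * nz by (simp add: divide_less_eq)
  finally have "N (\<lambda>y. inverse (f x) * f y) < 1" .
  from one_minus_invertible[OF in_A_cmult[OF f] this]
  obtain g where "\<And>y. (1 - inverse (f x) * f y) * g y = 1" by blast
  from this[of x] nz show False by simp
qed


section \<open>Ideals and the quotient seminorm\<close>

definition ideal_of :: "('a \<Rightarrow> complex) set \<Rightarrow> bool" where
  "ideal_of I \<longleftrightarrow> I \<subseteq> A \<and> (\<lambda>x. 0) \<in> I \<and> (\<forall>f\<in>I. \<forall>g\<in>I. (\<lambda>x. f x + g x) \<in> I) \<and>
     (\<forall>f\<in>A. \<forall>g\<in>I. (\<lambda>x. f x * g x) \<in> I)"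

context
  fixes M assumes M: "ideal_of M"
begin

lemma ideal_in_A: "f \<in> M \<Longrightarrow> f \<in> A"
  and ideal_zero: "(\<lambda>x. 0) \<in> M"
  and ideal_add: "f \<in> M \<Longrightarrow> g \<in> M \<Longrightarrow> (\<lambda>x. f x + g x) \<in> M"
  and ideal_mult: "f \<in> A \<Longrightarrow> g \<in> M \<Longrightarrow> (\<lambda>x. f x * g x) \<in> M"
  using M unfolding ideal_of_def by auto

lemma ideal_cmult: "g \<in> M \<Longrightarrow> (\<lambda>x. c * g x) \<in> M"
  by (rule ideal_mult[OF in_A_const])

lemma ideal_diff: "f \<in> M \<Longrightarrow> g \<in> M \<Longrightarrow> (\<lambda>x. f x - g x) \<in> M"
  using ideal_add[OF _ ideal_cmult[of g "-1"], of f] by simp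

lemmas ideal_intros = ideal_zero ideal_add ideal_mult ideal_cmult ideal_diff

text \<open>The norm of the coset of \<open>f\<close> in \<open>A / M\<close>, kept as a seminorm on
  \<open>A\<close> itself. No quotient type is formed; equality of cosets enters through
  \<open>quotient_norm_cong\<close>.\<close>

definition quotient_norm :: "('a \<Rightarrow> complex) \<Rightarrow> real" where
  "quotient_norm f = (INF m\<in>M. N (\<lambda>x. f x - m x))"

lemma quotient_norm_le: "f \<in> A \<Longrightarrow> m \<in> M \<Longrightarrow> quotient_norm f \<le> N (\<lambda>x. f x - m x)"
  unfolding quotient_norm_def
  by (intro cINF_lower bdd_belowI[where m=0]) (auto intro: in_A_intros norm_nonneg dest: ideal_in_A)

lemma quotient_norm_greatest:
  "(\<And>m. m \<in> M \<Longrightarrow> c \<le> N (\<lambda>x. f x - m x)) \<Longrightarrow> c \<le> quotient_norm f"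
  unfolding quotient_norm_def by (intro cINF_greatest) (auto intro: in_A_intros ideal_intros)

lemma quotient_norm_nonneg: "f \<in> A \<Longrightarrow> 0 \<le> quotient_norm f"
  by (intro quotient_norm_greatest) (auto intro: in_A_intros norm_nonneg dest: ideal_in_A)

lemma quotient_norm_cong:
  assumes "f \<in> A" "g \<in> A" "(\<lambda>x. f x - g x) \<in> M"
  shows "quotient_norm f \<le> quotient_norm g"
proof (rule quotient_norm_greatest)
  fix m assume "m \<in> M"
  then have "quotient_norm f \<le> N (\<lambda>x. f x - (m x + (f x - g x)))"
    using assms by (intro quotient_norm_le) (auto intro: in_A_intros ideal_intros)
  then show "quotient_norm f \<le> N (\<lambda>x. g x - m x)" by (simp add: algebra_simps)
qed

lemma quotient_norm_add:
  assumes "f \<in> A" "g \<in> A"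
  shows "quotient_norm (\<lambda>x. f x + g x) \<le> quotient_norm f + quotient_norm g"
proof -
  have "quotient_norm (\<lambda>x. f x + g x) - quotient_norm g \<le> quotient_norm f"
  proof (rule quotient_norm_greatest)
    fix m assume m: "m \<in> M"
    have "quotient_norm (\<lambda>x. f x + g x) - N (\<lambda>x. f x - m x) \<le> quotient_norm g"
    proof (rule quotient_norm_greatest)
      fix k assume k: "k \<in> M"
      have "quotient_norm (\<lambda>x. f x + g x) \<le> N (\<lambda>x. (f x + g x) - (m x + k x))"
        using assms m k by (intro quotient_norm_le) (auto intro: in_A_intros ideal_intros)
      also have "\<dots> = N (\<lambda>x. (f x - m x) + (g x - k x))" by (simp add: algebra_simps)
      also have "\<dots> \<le> N (\<lambda>x. f x - m x) + N (\<lambda>x. g x - k x)"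
        using assms m k by (intro norm_add) (auto intro: in_A_intros norm_nonneg dest: ideal_in_A)
      finally show "quotient_norm (\<lambda>x. f x + g x) - N (\<lambda>x. f x - m x) \<le> N (\<lambda>x. g x - k x)" by simp
    qed
    then show "quotient_norm (\<lambda>x. f x + g x) - quotient_norm g \<le> N (\<lambda>x. f x - m x)" by simp
  qed
  then show ?thesis by simp
qed

lemma quotient_norm_approx:
  assumes "0 < e" shows "\<exists>m\<in>M. N (\<lambda>x. f x - m x) < quotient_norm f + e"
proof (rule ccontr)
  assume "\<not> ?thesis"
  then have "quotient_norm f + e \<le> quotient_norm f" by (intro quotient_norm_greatest) force
  with assms show False by simp
qed

lemma quotient_norm_mult:
  assumes f: "f \<in> A" and g: "g \<in> A"
  shows "quotient_norm (\<lambda>x. f x * g x) \<le> quotient_norm f * quotient_norm g"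
proof (rule tendsto_lowerbound[where F = "at_right 0"])
  show "((\<lambda>e. (quotient_norm f + e) * (quotient_norm g + e)) \<longlongrightarrow> quotient_norm f * quotient_norm g)
      (at_right 0)"
    by (auto intro!: tendsto_eq_intros)
  have "quotient_norm (\<lambda>x. f x * g x) \<le> (quotient_norm f + e) * (quotient_norm g + e)"
    if e: "e > 0" for e
  proof -
    obtain m where m: "m \<in> M" "N (\<lambda>x. f x - m x) < quotient_norm f + e"
      using quotient_norm_approx[OF e] by blast
    obtain k where k: "k \<in> M" "N (\<lambda>x. g x - k x) < quotient_norm g + e"
      using quotient_norm_approx[OF e] by blast
    note mk = m(1) k(1) ideal_in_A[OF m(1)] ideal_in_A[OF k(1)]
    \<comment> \<open>Subtracting this element of \<open>M\<close> from \<open>f * g\<close> leaves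
      \<open>(f - m) * (g - k)\<close>, so the product of near-optimal representatives represents
      the product.\<close>
    have "(\<lambda>x. f x * k x + (g x - k x) * m x) \<in> M"
      using f g mk by (intro ideal_add ideal_mult in_A_diff)
    then have "quotient_norm (\<lambda>x. f x * g x)
        \<le> N (\<lambda>x. f x * g x - (f x * k x + (g x - k x) * m x))"
      using f g by (intro quotient_norm_le) (auto intro: in_A_intros ideal_intros)
    also have "\<dots> = N (\<lambda>x. (f x - m x) * (g x - k x))" by (simp add: algebra_simps)
    also have "\<dots> \<le> N (\<lambda>x. f x - m x) * N (\<lambda>x. g x - k x)"
      using f g mk by (intro norm_mult_le) (auto intro: in_A_intros ideal_intros)
    also have "\<dots> \<le> (quotient_norm f + e) * (quotient_norm g + e)"
      using m k mk f g e quotient_norm_nonneg[OF f] by (intro mult_mono) (auto intro: in_A_intros norm_nonneg)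
    finally show ?thesis .
  qed
  then show "\<forall>\<^sub>F e in at_right 0. quotient_norm (\<lambda>x. f x * g x) \<le> (quotient_norm f + e) * (quotient_norm g + e)"
    by (auto simp: eventually_at_right_less eventually_at_filter)
qed auto

lemma quotient_norm_cmult:
  assumes f: "f \<in> A" shows "quotient_norm (\<lambda>x. c * f x) \<le> cmod c * quotient_norm f"
proof (rule tendsto_lowerbound[where F = "at_right 0"])
  show "((\<lambda>e. cmod c * (quotient_norm f + e)) \<longlongrightarrow> cmod c * quotient_norm f) (at_right 0)"
    by (auto intro!: tendsto_eq_intros)
  have "quotient_norm (\<lambda>x. c * f x) \<le> cmod c * (quotient_norm f + e)" if e: "e > 0" for e
  proof -
    obtain m where m: "m \<in> M" "N (\<lambda>x. f x - m x) < quotient_norm f + e"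
      using quotient_norm_approx[OF e] by blast
    have "quotient_norm (\<lambda>x. c * f x) \<le> N (\<lambda>x. c * f x - c * m x)"
      using f m by (intro quotient_norm_le in_A_cmult) (auto intro: in_A_intros ideal_intros)
    also have "\<dots> = N (\<lambda>x. c * (f x - m x))" by (simp add: algebra_simps)
    also have "\<dots> = cmod c * N (\<lambda>x. f x - m x)"
      using f m ideal_in_A by (intro norm_cmult) (auto intro: in_A_intros ideal_intros)
    also have "\<dots> \<le> cmod c * (quotient_norm f + e)"
      using m by (intro mult_left_mono) (auto intro: in_A_intros ideal_intros)
    finally show ?thesis .
  qed
  then show "\<forall>\<^sub>F e in at_right 0. quotient_norm (\<lambda>x. c * f x) \<le> cmod c * (quotient_norm f + e)"
    by (auto simp: eventually_at_filter)
qed auto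

text \<open>An element of \<open>M\<close> at distance less than \<open>1\<close> from the constant
  \<open>1\<close> is invertible by the Neumann series, which would put \<open>1\<close> into
  \<open>M\<close>.\<close>

lemma quotient_norm_one:
  assumes "(\<lambda>x. 1) \<notin> M" shows "1 \<le> quotient_norm (\<lambda>x. 1)"
proof (rule quotient_norm_greatest, rule ccontr)
  fix m assume m: "m \<in> M" "\<not> 1 \<le> N (\<lambda>x. 1 - m x)"
  from m(2) have "N (\<lambda>x. 1 - m x) < 1" by simp
  from one_minus_invertible[OF in_A_diff[OF in_A_const ideal_in_A[OF m(1)]] this]
  obtain g where "g \<in> A" "\<And>x. (1 - (1 - m x)) * g x = 1" by blast
  then have "(\<lambda>x. g x * m x) = (\<lambda>x. 1)" by (auto simp: mult.commute)
  then show False using ideal_mult[OF \<open>g \<in> A\<close> m(1)] assms by simp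
qed

section \<open>Resolvents modulo an ideal and the Gelfand-Mazur theorem\<close>

lemma resolvent_identity:
  assumes "r \<in> A" "s \<in> A" "(\<lambda>x. (f x - a) * r x - 1) \<in> M" "(\<lambda>x. (f x - b) * s x - 1) \<in> M"
  shows "(\<lambda>x. r x - s x - (a - b) * (r x * s x)) \<in> M"
proof -
  have "(\<lambda>x. s x * ((f x - a) * r x - 1) - r x * ((f x - b) * s x - 1)) \<in> M"
    by (rule ideal_diff[OF ideal_mult[OF assms(2,3)] ideal_mult[OF assms(1,4)]])
  also have "(\<lambda>x. s x * ((f x - a) * r x - 1) - r x * ((f x - b) * s x - 1)) =
      (\<lambda>x. r x - s x - (a - b) * (r x * s x))" by (simp add: algebra_simps)
  finally show ?thesis .
qed

text \<open>This allows the resolvent identity to be applied to \<open>f ^ 2\<close> in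
  \<open>resolvent_four_point\<close>.\<close>

lemma resolvent_product:
  assumes "r \<in> A" "s \<in> A" "f \<in> A"
    and r: "(\<lambda>x. (f x - a) * r x - 1) \<in> M" and s: "(\<lambda>x. (f x + a) * s x - 1) \<in> M"
  shows "(\<lambda>x. (f x ^ 2 - a ^ 2) * (r x * s x) - 1) \<in> M"
proof -
  have "(\<lambda>x. ((f x + a) * s x) * ((f x - a) * r x - 1) + ((f x + a) * s x - 1)) \<in> M"
    using assms by (intro ideal_add[OF ideal_mult[OF _ r] s] in_A_mult in_A_add in_A_const)
  also have "(\<lambda>x. ((f x + a) * s x) * ((f x - a) * r x - 1) + ((f x + a) * s x - 1)) =
      (\<lambda>x. (f x ^ 2 - a ^ 2) * (r x * s x) - 1)" by (simp add: algebra_simps power2_eq_square)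
  finally show ?thesis .
qed

text \<open>Modulo \<open>M\<close> this is \<open>1/f - avg (1/(f - w)) = - a^4 / (f (f^4 - a^4))\<close>, where \<open>w\<close>
  runs through the fourth roots of \<open>a^4\<close>.\<close>

lemma resolvent_four_point:
  assumes A: "f \<in> A" "r0 \<in> A" "r1 \<in> A" "r2 \<in> A" "r3 \<in> A" "r4 \<in> A"
    and r0: "(\<lambda>x. f x * r0 x - 1) \<in> M"
    and r1: "(\<lambda>x. (f x - a) * r1 x - 1) \<in> M" and r2: "(\<lambda>x. (f x + a) * r2 x - 1) \<in> M"
    and r3: "(\<lambda>x. (f x - \<i> * a) * r3 x - 1) \<in> M" and r4: "(\<lambda>x. (f x + \<i> * a) * r4 x - 1) \<in> M"
  shows "(\<lambda>x. 4 * r0 x - (r1 x + r2 x + r3 x + r4 x - 4 * a ^ 4 * (r0 x * (r1 x * r2 x * r3 x * r4 x)))) \<in> M"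
proof -
  \<comment> \<open>Modulo \<open>M\<close> this is
    \<open>2/f - 1/(f - b) - 1/(f + b) = - 2 b^2 / (f (f^2 - b^2))\<close>. Its error has order
    \<open>b ^ 2\<close>, the same as the gain in the maximum principle, so one pair of points is
    not enough.\<close>
  have two: "(\<lambda>x. 2 * r0 x - r x - s x + 2 * b ^ 2 * (r0 x * (r x * s x))) \<in> M"
    if rs: "r \<in> A" "s \<in> A"
      and r: "(\<lambda>x. (f x - b) * r x - 1) \<in> M" and s: "(\<lambda>x. (f x + b) * s x - 1) \<in> M"
    for b r s
  proof -
    have r0': "(\<lambda>x. (f x - 0) * r0 x - 1) \<in> M" and s': "(\<lambda>x. (f x - (-b)) * s x - 1) \<in> M"
      using r0 s by simp_all
    have "(\<lambda>x. (r0 x - r x - (0 - b) * (r0 x * r x)) + (r0 x - s x - (0 - (- b)) * (r0 x * s x))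
        + (b * r0 x) * (s x - r x - (- b - b) * (s x * r x))) \<in> M"
      using A rs
      by (intro ideal_add ideal_mult in_A_cmult resolvent_identity[OF _ _ r0' r]
          resolvent_identity[OF _ _ r0' s'] resolvent_identity[OF _ _ s' r]) (auto intro: in_A_intros ideal_intros)
    also have "(\<lambda>x. (r0 x - r x - (0 - b) * (r0 x * r x)) + (r0 x - s x - (0 - (- b)) * (r0 x * s x))
        + (b * r0 x) * (s x - r x - (- b - b) * (s x * r x))) =
        (\<lambda>x. 2 * r0 x - r x - s x + 2 * b ^ 2 * (r0 x * (r x * s x)))"
      by (simp add: algebra_simps power2_eq_square)
    finally show ?thesis .
  qed
  \<comment> \<open>The products \<open>r1 * r2\<close> and \<open>r3 * r4\<close> invert
    \<open>f ^ 2 - a ^ 2\<close> and \<open>f ^ 2 + a ^ 2\<close>, so the resolvent identity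
    compares them. As \<open>(\<i> * a) ^ 2 = - (a ^ 2)\<close>, adding the two pairs cancels the
    quadratic errors and leaves order \<open>a ^ 4\<close>.\<close>
  have "(\<lambda>x. (f x ^ 2 - a ^ 2) * (r1 x * r2 x) - 1) \<in> M"
    using A r1 r2 by (intro resolvent_product)
  moreover have "(\<lambda>x. (f x ^ 2 - (\<i> * a) ^ 2) * (r3 x * r4 x) - 1) \<in> M"
    using A r3 r4 by (intro resolvent_product)
  ultimately have D: "(\<lambda>x. r1 x * r2 x - r3 x * r4 x - (a ^ 2 - (\<i> * a) ^ 2) * (r1 x * r2 x * (r3 x * r4 x))) \<in> M"
    using A by (intro resolvent_identity) (auto intro: in_A_intros ideal_intros)
  have "(\<lambda>x. ((2 * r0 x - r1 x - r2 x + 2 * a ^ 2 * (r0 x * (r1 x * r2 x)))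
      + (2 * r0 x - r3 x - r4 x + 2 * (\<i> * a) ^ 2 * (r0 x * (r3 x * r4 x))))
      - (2 * a ^ 2) * (r0 x * (r1 x * r2 x - r3 x * r4 x - (a ^ 2 - (\<i> * a) ^ 2) * (r1 x * r2 x * (r3 x * r4 x))))) \<in> M"
    using A by (intro ideal_add ideal_diff ideal_cmult ideal_mult D two r1 r2 r3 r4)
  also have "(\<lambda>x. ((2 * r0 x - r1 x - r2 x + 2 * a ^ 2 * (r0 x * (r1 x * r2 x)))
      + (2 * r0 x - r3 x - r4 x + 2 * (\<i> * a) ^ 2 * (r0 x * (r3 x * r4 x))))
      - (2 * a ^ 2) * (r0 x * (r1 x * r2 x - r3 x * r4 x - (a ^ 2 - (\<i> * a) ^ 2) * (r1 x * r2 x * (r3 x * r4 x))))) =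
    (\<lambda>x. 4 * r0 x - (r1 x + r2 x + r3 x + r4 x - 4 * a ^ 4 * (r0 x * (r1 x * r2 x * r3 x * r4 x))))"
  proof
    fix x
    have i: "(\<i> * a) ^ 2 = - (a ^ 2)" by (simp add: power_mult_distrib)
    show "((2 * r0 x - r1 x - r2 x + 2 * a ^ 2 * (r0 x * (r1 x * r2 x)))
      + (2 * r0 x - r3 x - r4 x + 2 * (\<i> * a) ^ 2 * (r0 x * (r3 x * r4 x))))
      - (2 * a ^ 2) * (r0 x * (r1 x * r2 x - r3 x * r4 x - (a ^ 2 - (\<i> * a) ^ 2) * (r1 x * r2 x * (r3 x * r4 x)))) =
      4 * r0 x - (r1 x + r2 x + r3 x + r4 x - 4 * a ^ 4 * (r0 x * (r1 x * r2 x * r3 x * r4 x)))"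
      unfolding i by algebra
  qed
  finally show ?thesis .
qed

text \<open>If no \<open>f - c\<close> lies in \<open>M\<close>, then all are invertible modulo
  \<open>M\<close>. The seminorm \<open>u c\<close> of the resolvent is continuous, tends to
  \<open>0\<close> at infinity and satisfies the four-point inequality, so \<open>u 0 = 0\<close>.
  But \<open>f * r 0\<close> is \<open>1\<close> modulo \<open>M\<close> and has seminorm at least
  \<open>1\<close>.\<close>

lemma gelfand_mazur:
  assumes proper: "(\<lambda>x. 1) \<notin> M" and f: "f \<in> A"
    and inv: "\<And>g. g \<in> A \<Longrightarrow> g \<notin> M \<Longrightarrow> \<exists>h\<in>A. (\<lambda>x. g x * h x - 1) \<in> M"
  shows "\<exists>c. (\<lambda>x. f x - c) \<in> M"
proof (rule ccontr)
  assume "\<not> ?thesis"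
  then have "\<exists>h. h \<in> A \<and> (\<lambda>x. (f x - c) * h x - 1) \<in> M" for c
    using inv[OF in_A_diff[OF f in_A_const], of c] by blast
  then have "\<forall>c. \<exists>h. h \<in> A \<and> (\<lambda>x. (f x - c) * h x - 1) \<in> M" by blast
  from choice[OF this] obtain r where rA: "\<And>c. r c \<in> A"
    and r: "\<And>c. (\<lambda>x. (f x - c) * r c x - 1) \<in> M" by blast
  define u where "u = (\<lambda>c. quotient_norm (r c))"
  have u0: "u c \<ge> 0" for c unfolding u_def using rA by (rule quotient_norm_nonneg)
  have diff: "u a - u b \<le> cmod (a - b) * (u a * u b)" for a b
  proof -
    have "u a \<le> quotient_norm (\<lambda>x. r b x + (a - b) * (r a x * r b x))"
      unfolding u_def using resolvent_identity[OF rA rA r r, of a b] rA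
      by (intro quotient_norm_cong in_A_add in_A_cmult in_A_mult) (auto simp: algebra_simps)
    also have "\<dots> \<le> quotient_norm (r b) + quotient_norm (\<lambda>x. (a - b) * (r a x * r b x))"
      using rA by (intro quotient_norm_add in_A_cmult in_A_mult)
    also have "\<dots> \<le> u b + cmod (a - b) * quotient_norm (\<lambda>x. r a x * r b x)"
      unfolding u_def using rA by (intro add_left_mono quotient_norm_cmult in_A_mult)
    also have "\<dots> \<le> u b + cmod (a - b) * (u a * u b)"
      unfolding u_def using rA by (intro add_left_mono mult_left_mono quotient_norm_mult) (auto intro: in_A_intros ideal_intros)
    finally show ?thesis by simp
  qed
  have cont: "continuous_on UNIV u"
    unfolding continuous_on_eq_continuous_at[OF open_UNIV]
  proof
    fix b
    \<comment> \<open>Near \<open>b\<close> the estimate \<open>diff\<close> first yields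
      \<open>u a \<le> 2 * u b\<close>; inserting this back removes \<open>u a\<close> from its
      right-hand side.\<close>
    have bound: "\<bar>u a - u b\<bar> \<le> cmod (a - b) * (2 * u b * u b)" if "cmod (a - b) * u b \<le> 1 / 2" for a
    proof -
      have "u a - u b \<le> (1/2) * u a"
        using diff[of a b] mult_right_mono[OF that u0[of a]] by (simp add: mult_ac)
      then have "u a \<le> 2 * u b" by simp
      then have "u a * u b \<le> 2 * u b * u b" using u0 by (intro mult_right_mono) (auto intro: in_A_intros ideal_intros)
      then have "cmod (a - b) * (u a * u b) \<le> cmod (a - b) * (2 * u b * u b)"
        by (intro mult_left_mono) (auto intro: in_A_intros ideal_intros)
      with diff[of a b] diff[of b a] show ?thesis by (simp add: norm_minus_commute mult_ac)
    qed
    have "((\<lambda>a. cmod (a - b) * u b) \<longlongrightarrow> 0) (at b)" by (auto intro!: tendsto_eq_intros)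
    then have "\<forall>\<^sub>F a in at b. cmod (a - b) * u b < 1 / 2" by (rule order_tendstoD) (auto intro: in_A_intros ideal_intros)
    then have "\<forall>\<^sub>F a in at b. norm (u a - u b) \<le> cmod (a - b) * (2 * u b * u b)"
      by eventually_elim (use bound in auto)
    moreover have "((\<lambda>a. cmod (a - b) * (2 * u b * u b)) \<longlongrightarrow> 0) (at b)"
      by (auto intro!: tendsto_eq_intros)
    ultimately have "((\<lambda>a. u a - u b) \<longlongrightarrow> 0) (at b)" by (rule Lim_null_comparison)
    then show "isCont u b" unfolding isCont_def by (simp add: LIM_zero_iff)
  qed
  have lim: "(u \<longlongrightarrow> 0) at_infinity"
  proof (rule Lim_null_comparison)
    let ?q1 = "quotient_norm (\<lambda>x. 1)" and ?qf = "quotient_norm f"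
    \<comment> \<open>Modulo \<open>M\<close>, \<open>c * r c = f * r c - 1\<close>. Taking
      seminorms gives decay like \<open>1 / cmod c\<close>.\<close>
    have "(cmod c - ?qf) * u c \<le> ?q1" for c
    proof -
      have m: "(\<lambda>x. (-1) * ((f x - c) * r c x - 1)) \<in> M" using r by (rule ideal_cmult)
      show ?thesis
      proof (cases "c = 0")
        case True
        have "0 \<le> ?qf * u c" using u0 f by (intro mult_nonneg_nonneg quotient_norm_nonneg)
        moreover have "0 \<le> ?q1" by (intro quotient_norm_nonneg) (auto intro: in_A_intros ideal_intros)
        ultimately show ?thesis using True by simp
      next
        case False
        have "(\<lambda>x. (1/c) * ((-1) * ((f x - c) * r c x - 1))) \<in> M" using m by (rule ideal_cmult)
        also have "(\<lambda>x. (1/c) * ((-1) * ((f x - c) * r c x - 1))) =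
            (\<lambda>x. r c x - (1/c) * (f x * r c x + (-1) * 1))"
          using False by (simp add: field_simps)
        finally have "u c \<le> quotient_norm (\<lambda>x. (1/c) * (f x * r c x + (-1) * 1))"
          unfolding u_def using rA f by (intro quotient_norm_cong in_A_cmult in_A_add in_A_mult) (auto intro: in_A_intros ideal_intros)
        also have "\<dots> \<le> cmod (1/c) * quotient_norm (\<lambda>x. f x * r c x + (-1) * 1)"
          using rA f by (intro quotient_norm_cmult in_A_add in_A_mult) (auto intro: in_A_intros ideal_intros)
        finally have "cmod c * u c \<le> quotient_norm (\<lambda>x. f x * r c x + (-1) * 1)"
          using False by (simp add: norm_divide field_simps)
        also have "\<dots> \<le> quotient_norm (\<lambda>x. f x * r c x) + quotient_norm (\<lambda>x. (-1) * 1)"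
          using rA f by (intro quotient_norm_add in_A_mult) (auto intro: in_A_intros ideal_intros)
        also have "\<dots> \<le> ?qf * u c + cmod (-1) * ?q1"
          unfolding u_def using rA f by (intro add_mono quotient_norm_mult quotient_norm_cmult) (auto intro: in_A_intros ideal_intros)
        finally show ?thesis by (simp add: algebra_simps)
      qed
    qed
    then have "norm (u c) \<le> ?q1 / (cmod c - ?qf)" if "cmod c > ?qf" for c
      using that u0[of c] by (simp add: field_simps)
    moreover have "\<forall>\<^sub>F c in at_infinity. cmod c > ?qf"
      unfolding eventually_at_infinity by (rule exI[of _ "?qf + 1"]) (auto intro: in_A_intros ideal_intros)
    ultimately show "\<forall>\<^sub>F c in at_infinity. norm (u c) \<le> ?q1 / (cmod c - ?qf)"
      by (auto elim: eventually_mono)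
    show "((\<lambda>c. ?q1 / (cmod c - ?qf)) \<longlongrightarrow> 0) at_infinity"
    proof (rule real_tendsto_divide_at_top[OF tendsto_const])
      show "LIM c at_infinity. cmod c - ?qf :> at_top"
        using filterlim_tendsto_add_at_top[OF tendsto_const filterlim_norm_at_top, of "- ?qf"] by simp
    qed
  qed
  have mean: "\<exists>C. \<forall>z \<rho>. cmod z \<le> R \<longrightarrow> 0 < \<rho> \<longrightarrow> \<rho> \<le> 1 \<longrightarrow>
      4 * u z \<le> u (z + of_real \<rho>) + u (z - of_real \<rho>) +
        u (z + \<i> * of_real \<rho>) + u (z - \<i> * of_real \<rho>) + C * \<rho> ^ 4" for R
  proof -
    have "compact (u ` cball 0 (R + 1))"
      by (intro compact_continuous_image continuous_on_subset[OF cont]) (auto intro: in_A_intros ideal_intros)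
    then have "bounded (u ` cball 0 (R + 1))" by (rule compact_imp_bounded)
    then obtain K where K0: "K > 0" "\<forall>v\<in>u ` cball 0 (R + 1). norm v \<le> K"
      unfolding bounded_pos by blast
    have K: "u z \<le> K" if "cmod z \<le> R + 1" for z
      using bspec[OF K0(2), of "u z"] that by (auto intro: in_A_intros ideal_intros)
    \<comment> \<open>\<open>K\<close> bounds \<open>u\<close> on the disc of radius
      \<open>R + 1\<close>, which contains all five points. The error term of
      \<open>resolvent_four_point\<close> is \<open>4 * a ^ 4\<close> times a product of five
      resolvents, hence the constant \<open>4 * K ^ 5\<close>.\<close>
    have "4 * u z \<le> u (z + of_real \<rho>) + u (z - of_real \<rho>) +
        u (z + \<i> * of_real \<rho>) + u (z - \<i> * of_real \<rho>) + (4 * K ^ 5) * \<rho> ^ 4"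
      if z: "cmod z \<le> R" and \<rho>: "0 < \<rho>" "\<rho> \<le> 1" for z \<rho>
    proof -
      let ?a = "of_real \<rho> :: complex"
      let ?r0 = "r z" and ?r1 = "r (z + ?a)" and ?r2 = "r (z - ?a)"
        and ?r3 = "r (z + \<i> * ?a)" and ?r4 = "r (z - \<i> * ?a)"
      let ?p = "\<lambda>x. ?r0 x * (?r1 x * ?r2 x * ?r3 x * ?r4 x)"
      have E: "(\<lambda>x. 4 * ?r0 x - (?r1 x + ?r2 x + ?r3 x + ?r4 x - 4 * ?a ^ 4 * ?p x)) \<in> M"
      proof (rule resolvent_four_point[where f = "\<lambda>x. f x - z"])
        show "(\<lambda>x. (f x - z) * ?r0 x - 1) \<in> M" by (rule r)
        show "(\<lambda>x. (f x - z - ?a) * ?r1 x - 1) \<in> M" using r[of "z + ?a"] by (simp add: algebra_simps)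
        show "(\<lambda>x. (f x - z + ?a) * ?r2 x - 1) \<in> M" using r[of "z - ?a"] by (simp add: algebra_simps)
        show "(\<lambda>x. (f x - z - \<i> * ?a) * ?r3 x - 1) \<in> M" using r[of "z + \<i> * ?a"] by (simp add: algebra_simps)
        show "(\<lambda>x. (f x - z + \<i> * ?a) * ?r4 x - 1) \<in> M" using r[of "z - \<i> * ?a"] by (simp add: algebra_simps)
      qed (use rA f in \<open>auto intro: in_A_intros\<close>)
      have near: "u w \<le> K" if "cmod (w - z) \<le> \<rho>" for w
        using K[of w] norm_triangle_ineq[of "w - z" z] that z \<rho> by simp
      have Kb: "u z \<le> K" "u (z + ?a) \<le> K" "u (z - ?a) \<le> K" "u (z + \<i> * ?a) \<le> K" "u (z - \<i> * ?a) \<le> K"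
        using \<rho> by (auto intro!: near simp: norm_mult)
      have prod: "quotient_norm (\<lambda>x. g x * h x) \<le> s * t"
        if "g \<in> A" "h \<in> A" "quotient_norm g \<le> s" "quotient_norm h \<le> t" for g h s t
        using quotient_norm_mult[OF that(1,2)] that quotient_norm_nonneg[OF that(1)]
          quotient_norm_nonneg[OF that(2)]
        by (meson mult_mono order_trans)
      have "quotient_norm ?p \<le> K * (K * K * K * K)"
        using rA Kb by (intro prod in_A_mult) (auto simp: u_def)
      then have p: "quotient_norm ?p \<le> K ^ 5" by (simp add: eval_nat_numeral mult_ac)
      let ?s = "\<lambda>x. ?r1 x + ?r2 x + ?r3 x + ?r4 x"
      have pA: "?p \<in> A" using rA by (intro in_A_mult)
      have sA: "?s \<in> A" using rA by (intro in_A_add)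
      have ss: "quotient_norm ?s \<le> u (z + ?a) + u (z - ?a) + u (z + \<i> * ?a) + u (z - \<i> * ?a)"
        unfolding u_def using rA
        by (intro order_trans[OF quotient_norm_add] add_mono order_refl in_A_add)
      have "4 * u z \<le> quotient_norm (\<lambda>x. 4 * ?r0 x)"
      proof -
        have "quotient_norm (\<lambda>x. (1/4) * (4 * ?r0 x)) \<le> cmod (1/4) * quotient_norm (\<lambda>x. 4 * ?r0 x)"
          using rA by (intro quotient_norm_cmult in_A_cmult)
        then show ?thesis by (simp add: u_def)
      qed
      also have "\<dots> \<le> quotient_norm (\<lambda>x. ?s x + (- 4 * ?a ^ 4) * ?p x)"
        using E pA sA rA by (intro quotient_norm_cong in_A_cmult in_A_add) (auto intro: in_A_intros ideal_intros)
      also have "\<dots> \<le> quotient_norm ?s + quotient_norm (\<lambda>x. (- 4 * ?a ^ 4) * ?p x)"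
        using pA sA by (intro quotient_norm_add in_A_cmult)
      also have "\<dots> \<le> quotient_norm ?s + cmod (- 4 * ?a ^ 4) * quotient_norm ?p"
        using pA by (intro add_left_mono quotient_norm_cmult)
      also have "\<dots> \<le> quotient_norm ?s + (4 * \<rho> ^ 4) * K ^ 5"
        using p \<rho> by (intro add_left_mono mult_mono) (auto simp: norm_mult norm_power quotient_norm_nonneg[OF pA])
      finally show ?thesis using ss by (simp add: mult_ac)
    qed
    then show ?thesis by blast
  qed
  have "u 0 \<le> 0" using cont lim mean by (rule four_point_maximum_principle)
  with u0[of 0] have "u 0 = 0" by simp
  have "1 \<le> quotient_norm (\<lambda>x. 1)" using proper by (rule quotient_norm_one)
  also have "\<dots> \<le> quotient_norm (\<lambda>x. f x * r 0 x)"
    using ideal_cmult[OF r[of 0], of "-1"] rA f by (intro quotient_norm_cong) (auto intro: in_A_intros ideal_intros)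
  also have "\<dots> \<le> quotient_norm f * quotient_norm (r 0)" using rA f by (intro quotient_norm_mult)
  also have "\<dots> = 0" using \<open>u 0 = 0\<close> by (simp add: u_def)
  finally show False by simp
qed

end


section \<open>Maximal ideals and characters\<close>

lemma proper_ideal_le_maximal:
  assumes I: "ideal_of I" and "(\<lambda>x. 1) \<notin> I"
  shows "\<exists>M. ideal_of M \<and> (\<lambda>x. 1) \<notin> M \<and> I \<subseteq> M \<and>
    (\<forall>J. ideal_of J \<longrightarrow> (\<lambda>x. 1) \<notin> J \<longrightarrow> M \<subseteq> J \<longrightarrow> J = M)"
proof -
  define P where "P = {J. ideal_of J \<and> (\<lambda>x. 1) \<notin> J \<and> I \<subseteq> J}"
  have "\<exists>M\<in>P. \<forall>J\<in>P. M \<subseteq> J \<longrightarrow> J = M"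
  proof (rule subset_Zorn_nonempty)
    show "P \<noteq> {}" using assms by (auto simp: P_def)
    fix C assume "C \<noteq> {}" and chain: "subset.chain P C"
    then have C: "\<And>J. J \<in> C \<Longrightarrow> ideal_of J \<and> (\<lambda>x. 1) \<notin> J \<and> I \<subseteq> J"
      by (auto simp: subset.chain_def P_def)
    have "ideal_of (\<Union>C)"
      unfolding ideal_of_def
    proof (intro conjI ballI)
      show "\<Union>C \<subseteq> A" using C unfolding ideal_of_def by blast
      show "(\<lambda>x. 0) \<in> \<Union>C" using C \<open>C \<noteq> {}\<close> by (auto simp: ideal_of_def)
      fix f g assume "f \<in> \<Union>C" "g \<in> \<Union>C"
      then obtain J K where JK: "J \<in> C" "f \<in> J" "K \<in> C" "g \<in> K" by auto
      then have "J \<subseteq> K \<or> K \<subseteq> J" using chain by (auto simp: subset.chain_def)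
      with JK obtain L where "L \<in> C" "f \<in> L" "g \<in> L" by blast
      then show "(\<lambda>x. f x + g x) \<in> \<Union>C" using C[of L] by (auto simp: ideal_of_def)
    next
      fix f g assume "f \<in> A" "g \<in> \<Union>C"
      then obtain J where "J \<in> C" "g \<in> J" by blast
      with C[of J] \<open>f \<in> A\<close> show "(\<lambda>x. f x * g x) \<in> \<Union>C" unfolding ideal_of_def by blast
    qed
    with C \<open>C \<noteq> {}\<close> show "\<Union>C \<in> P" unfolding P_def by blast
  qed
  then obtain M where M: "M \<in> P" "\<forall>J\<in>P. M \<subseteq> J \<longrightarrow> J = M" by (rule bexE)
  have "J = M" if "ideal_of J" "(\<lambda>x. 1) \<notin> J" "M \<subseteq> J" for J
  proof -
    have "J \<in> P" using that M(1) unfolding P_def by auto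
    with M(2) \<open>M \<subseteq> J\<close> show ?thesis by simp
  qed
  with M(1) show ?thesis unfolding P_def by (intro exI[of _ M]) simp
qed

text \<open>Modulo a maximal ideal every nonzero element is invertible, so Gelfand-Mazur makes each
  \<open>f\<close> congruent to a constant. That constant is unique because \<open>M\<close> is
  proper, and it is the value of the character.\<close>

lemma maximal_ideal_character:
  assumes M: "ideal_of M" and proper: "(\<lambda>x. 1) \<notin> M"
    and max: "\<And>J. ideal_of J \<Longrightarrow> (\<lambda>x. 1) \<notin> J \<Longrightarrow> M \<subseteq> J \<Longrightarrow> J = M"
  shows "\<exists>\<phi>\<in>characters A. \<forall>f\<in>M. \<phi> f = 0"
proof -
  note add = ideal_add[OF M] and mult = ideal_mult[OF M] and cmult = ideal_cmult[OF M]
    and sub = ideal_in_A[OF M] and diff = ideal_diff[OF M]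
  have inv: "\<exists>h\<in>A. (\<lambda>x. g x * h x - 1) \<in> M" if g: "g \<in> A" "g \<notin> M" for g
  proof -
    \<comment> \<open>The ideal generated by \<open>M\<close> and \<open>g\<close>. Maximality
      forces \<open>1\<close> into it, and the coefficient of \<open>g\<close> is the inverse
      sought.\<close>
    define J where "J = {\<lambda>x. m x + g x * h x | m h. m \<in> M \<and> h \<in> A}"
    have JI: "(\<lambda>x. m x + g x * h x) \<in> J" if "m \<in> M" "h \<in> A" for m h
      using that unfolding J_def by blast
    have J: "ideal_of J"
      unfolding ideal_of_def
    proof (intro conjI ballI)
      show "J \<subseteq> A"
      proof
        fix k assume "k \<in> J"
        then obtain m h where "k = (\<lambda>x. m x + g x * h x)" "m \<in> M" "h \<in> A"
          unfolding J_def by blast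
        then show "k \<in> A" using in_A_add[OF sub in_A_mult[OF g(1)], of m h] by simp
      qed
      show "(\<lambda>x. 0) \<in> J" using JI[OF ideal_zero[OF M] in_A_const[of 0]] by simp
      fix f k assume "f \<in> J" "k \<in> J"
      then obtain m h m' h' where *: "f = (\<lambda>x. m x + g x * h x)" "m \<in> M" "h \<in> A"
        "k = (\<lambda>x. m' x + g x * h' x)" "m' \<in> M" "h' \<in> A" unfolding J_def by blast
      show "(\<lambda>x. f x + k x) \<in> J"
        using JI[OF add[OF *(2,5)] in_A_add[OF *(3,6)]] by (simp add: * algebra_simps)
    next
      fix f k assume f: "f \<in> A" and "k \<in> J"
      then obtain m h where *: "k = (\<lambda>x. m x + g x * h x)" "m \<in> M" "h \<in> A"
        unfolding J_def by blast
      show "(\<lambda>x. f x * k x) \<in> J"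
        using JI[OF mult[OF f *(2)] in_A_mult[OF f *(3)]] by (simp add: * algebra_simps)
    qed
    have "M \<subseteq> J"
    proof
      show "m \<in> J" if "m \<in> M" for m using JI[OF that in_A_const[of 0]] by simp
    qed
    have "g \<in> J" using JI[OF ideal_zero[OF M] in_A_const[of 1]] by simp
    with g(2) have "J \<noteq> M" by blast
    with max[OF J _ \<open>M \<subseteq> J\<close>] have "(\<lambda>x. 1) \<in> J" by fast
    then obtain m h where mh: "(\<lambda>x. 1) = (\<lambda>x. m x + g x * h x)" "m \<in> M" "h \<in> A"
      unfolding J_def by blast
    have "(\<lambda>x. g x * h x - 1) = (\<lambda>x. (-1) * m x)"
    proof
      show "g x * h x - 1 = (-1) * m x" for x using fun_cong[OF mh(1), of x] by algebra
    qed
    with cmult[OF mh(2), of "-1"] have "(\<lambda>x. g x * h x - 1) \<in> M" by simp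
    with mh(3) show ?thesis by blast
  qed
  define \<phi> where "\<phi> = restrict (\<lambda>f. THE c. (\<lambda>x. f x - c) \<in> M) A"
  have uniq: "c = d" if c: "(\<lambda>x. f x - c) \<in> M" and d: "(\<lambda>x. f x - d) \<in> M" for f c d
  proof (rule ccontr)
    assume "c \<noteq> d"
    have "(\<lambda>x. (1 / (c - d)) * ((f x - d) - (f x - c))) \<in> M"
      by (rule cmult[OF diff[OF d c]])
    also have "(\<lambda>x. (1 / (c - d)) * ((f x - d) - (f x - c))) = (\<lambda>x. 1)"
      using \<open>c \<noteq> d\<close> by simp
    finally show False using proper by simp
  qed
  have eqI: "\<phi> f = c" if "f \<in> A" "(\<lambda>x. f x - c) \<in> M" for f c
  proof -
    have "(THE c. (\<lambda>x. f x - c) \<in> M) = c"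
      using that(2) uniq[OF _ that(2)] by (rule the_equality)
    then show ?thesis using that(1) by (simp add: \<phi>_def)
  qed
  have phi: "(\<lambda>x. f x - \<phi> f) \<in> M" if f: "f \<in> A" for f
  proof -
    from gelfand_mazur[OF M proper f inv] obtain c where c: "(\<lambda>x. f x - c) \<in> M" by blast
    show ?thesis unfolding eqI[OF f c] by (rule c)
  qed
  have "\<phi> \<in> characters A"
    unfolding characters_def
  proof (intro CollectI conjI ballI allI)
    show "\<phi> \<in> extensional A" by (simp add: \<phi>_def)
    have "\<phi> (\<lambda>x. 1) = 1" using eqI[OF in_A_const[of 1], of 1] ideal_zero[OF M] by simp
    then show "\<exists>f\<in>A. \<phi> f \<noteq> 0" by (intro bexI[OF _ in_A_const[of 1]]) simp
    fix f assume f: "f \<in> A"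
    show "\<phi> (\<lambda>x. c * f x) = c * \<phi> f" for c
      using cmult[OF phi[OF f], of c] by (intro eqI[OF in_A_cmult[OF f]]) (simp only: right_diff_distrib)
    fix g assume g: "g \<in> A"
    have "(\<lambda>x. (f x - \<phi> f) + (g x - \<phi> g)) = (\<lambda>x. f x + g x - (\<phi> f + \<phi> g))"
      by (simp add: algebra_simps)
    then show "\<phi> (\<lambda>x. f x + g x) = \<phi> f + \<phi> g"
      using add[OF phi[OF f] phi[OF g]] by (intro eqI[OF in_A_add[OF f g]]) (simp only:)
    have "(\<lambda>x. f x * (g x - \<phi> g) + \<phi> g * (f x - \<phi> f)) = (\<lambda>x. f x * g x - \<phi> f * \<phi> g)"
      by (simp add: algebra_simps)
    then show "\<phi> (\<lambda>x. f x * g x) = \<phi> f * \<phi> g"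
      using add[OF mult[OF f phi[OF g]] cmult[OF phi[OF f], of "\<phi> g"]]
      by (intro eqI[OF in_A_mult[OF f g]]) (simp only:)
  qed
  moreover have "\<forall>f\<in>M. \<phi> f = 0"
  proof
    fix f assume f: "f \<in> M"
    then show "\<phi> f = 0" by (intro eqI[OF sub[OF f]]) simp
  qed
  ultimately show ?thesis by (intro bexI[of _ \<phi>])
qed

section \<open>Point evaluations in the maximal ideal space\<close>

definition evaluation :: "'a \<Rightarrow> ('a \<Rightarrow> complex) \<Rightarrow> complex" where
  "evaluation x = restrict (\<lambda>f. f x) A"

lemma evaluation_eq: "f \<in> A \<Longrightarrow> evaluation x f = f x"
  by (simp add: evaluation_def)

lemma evaluation_character: "evaluation x \<in> characters A"
  unfolding characters_def
proof (intro CollectI conjI ballI allI)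
  show "evaluation x \<in> extensional A" by (simp add: evaluation_def)
  show "\<exists>f\<in>A. evaluation x f \<noteq> 0"
    using evaluation_eq[OF in_A_const[of 1]] by (intro bexI[OF _ in_A_const[of 1]]) simp
qed (simp_all add: evaluation_eq in_A_add in_A_cmult in_A_mult)

text \<open>Evaluation is continuous into the Gelfand topology, so it sends compact sets to compact,
  hence closed, subsets of a Hausdorff space. This transfers regularity from the maximal ideal space
  to \<open>X\<close>.\<close>

lemma closedin_evaluation_image:
  assumes "closed C" shows "closedin (maximal_ideal_space A) (evaluation ` C)"
proof (rule compactin_imp_closedin)
  show "Hausdorff_space (maximal_ideal_space A)"
    unfolding maximal_ideal_space_def
    by (intro Hausdorff_space_subtopology) (simp add: Hausdorff_space_product_topology)
  have "continuous_map euclidean (maximal_ideal_space A) evaluation"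
    unfolding maximal_ideal_space_def continuous_map_in_subtopology continuous_map_componentwise
  proof (intro conjI ballI)
    show "evaluation \<in> topspace euclidean \<rightarrow> characters A" using evaluation_character by blast
    show "evaluation ` topspace euclidean \<subseteq> extensional A" by (auto simp: evaluation_def)
    show "continuous_map euclidean euclidean (\<lambda>x. evaluation x f)" if "f \<in> A" for f
      using in_A_continuous[OF that] by (simp add: evaluation_eq[OF that])
  qed
  moreover have "compactin euclidean C"
    using compact_Int_closed[OF compact_UNIV assms] by simp
  ultimately show "compactin (maximal_ideal_space A) (evaluation ` C)"
    by (intro image_compactin)
qed

end

section \<open>Consequences of regularity\<close>

locale regular_compact_banach_function_algebra = compact_banach_function_algebra +
  assumes regular: "regular_algebra A"
begin

lemma separate_character_closed:
  assumes "closedin (maximal_ideal_space A) K" "\<phi> \<in> characters A" "\<phi> \<notin> K"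
  shows "\<exists>f\<in>A. \<phi> f = 1 \<and> (\<forall>\<psi>\<in>K. \<psi> f = 0)"
proof -
  have "\<phi> \<in> topspace (maximal_ideal_space A)"
    using assms(2) by (auto simp: maximal_ideal_space_def characters_def PiE_def)
  with assms show ?thesis
    using regular unfolding regular_algebra_def gelfand_transform_def by blast
qed

text \<open>A function vanishing on \<open>X\<close> is zero, so regularity could not separate another character
  from the closed set of evaluations.\<close>

lemma character_is_evaluation:
  assumes "\<phi> \<in> characters A"
  shows "\<exists>x. \<forall>f\<in>A. \<phi> f = f x"
proof (cases "\<phi> \<in> range evaluation")
  case True
  then show ?thesis by (auto simp: evaluation_eq)
next
  case False
  from separate_character_closed[OF closedin_evaluation_image[OF closed_UNIV] assms False]
  obtain f where f: "f \<in> A" "\<phi> f = 1" "\<forall>x. evaluation x f = 0" by blast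
  then have "f = (\<lambda>x. 0 * f x)" by (auto simp: evaluation_eq)
  moreover have "\<phi> (\<lambda>x. 0 * f x) = 0 * \<phi> f" using assms f(1) unfolding characters_def by blast
  ultimately show ?thesis using f(2) by simp
qed

text \<open>Since \<open>A\<close> separates points, \<open>evaluation\<close> is injective and
  \<open>evaluation x\<close> stays outside the image of \<open>K\<close>.\<close>

lemma separate_point_closed:
  assumes "closed K" "x \<notin> K"
  shows "\<exists>f\<in>A. f x = 1 \<and> (\<forall>y\<in>K. f y = 0)"
proof -
  have "evaluation x \<notin> evaluation ` K"
  proof
    assume "evaluation x \<in> evaluation ` K"
    then obtain y where y: "y \<in> K" "evaluation x = evaluation y" by auto
    then have "x \<noteq> y" using assms by auto
    then obtain f where "f \<in> A" "f x \<noteq> f y" using separates_points by blast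
    with fun_cong[OF y(2), of f] show False by (simp add: evaluation_def)
  qed
  from separate_character_closed[OF closedin_evaluation_image[OF assms(1)] evaluation_character this]
  obtain f where f: "f \<in> A" "evaluation x f = 1" "\<forall>y\<in>K. evaluation y f = 0" by blast
  then show ?thesis by (intro bexI[of _ f]) (simp_all add: evaluation_eq)
qed

text \<open>A proper ideal lies in a maximal one, on which some character vanishes. That character
  is evaluation at a point, which would be a common zero.\<close>

lemma ideal_without_common_zero:
  assumes I: "ideal_of I" and nz: "\<And>x. \<exists>f\<in>I. f x \<noteq> 0"
  shows "(\<lambda>x. 1) \<in> I"
proof (rule ccontr)
  assume "(\<lambda>x. 1) \<notin> I"
  from proper_ideal_le_maximal[OF I this]
  obtain M where M: "ideal_of M" "(\<lambda>x. 1) \<notin> M" "I \<subseteq> M"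
    and max: "\<forall>J. ideal_of J \<longrightarrow> (\<lambda>x. 1) \<notin> J \<longrightarrow> M \<subseteq> J \<longrightarrow> J = M" by blast
  have "\<exists>\<phi>\<in>characters A. \<forall>f\<in>M. \<phi> f = 0"
    using M(1,2) by (rule maximal_ideal_character) (use max in blast)
  then obtain \<phi> where \<phi>: "\<phi> \<in> characters A" "\<forall>f\<in>M. \<phi> f = 0" by blast
  obtain x where x: "\<forall>f\<in>A. \<phi> f = f x" using character_is_evaluation[OF \<phi>(1)] by blast
  obtain f where "f \<in> I" "f x \<noteq> 0" using nz[of x] by blast
  with M(3) have "f \<in> M" "f \<in> A" by (auto intro: ideal_in_A[OF M(1)])
  with bspec[OF \<phi>(2), of f] bspec[OF x, of f] \<open>f x \<noteq> 0\<close> show False by simp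
qed

text \<open>Functions vanishing on \<open>K\<close> plus functions vanishing on \<open>L\<close>
  form an ideal. Separation of points from closed sets excludes common zeros, so
  \<open>1 = f + g\<close>, and \<open>f\<close> is the function wanted.\<close>

lemma separate_closed_sets:
  assumes "closed K" "closed L" "K \<inter> L = {}"
  shows "\<exists>f\<in>A. (\<forall>x\<in>K. f x = 0) \<and> (\<forall>x\<in>L. f x = 1)"
proof -
  define I where "I = {\<lambda>x. f x + g x | f g. f \<in> A \<and> g \<in> A \<and> (\<forall>x\<in>K. f x = 0) \<and> (\<forall>x\<in>L. g x = 0)}"
  have II: "(\<lambda>x. f x + g x) \<in> I" if "f \<in> A" "g \<in> A" "\<forall>x\<in>K. f x = 0" "\<forall>x\<in>L. g x = 0" for f g
    using that unfolding I_def by blast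
  have "ideal_of I"
    unfolding ideal_of_def
  proof (intro conjI ballI)
    show "I \<subseteq> A" unfolding I_def by (auto intro: in_A_add)
    show "(\<lambda>x. 0) \<in> I" using II[of "\<lambda>x. 0" "\<lambda>x. 0"] in_A_const[of 0] by simp
    fix u v assume "u \<in> I" "v \<in> I"
    then obtain f g f' g' where *: "u = (\<lambda>x. f x + g x)" "v = (\<lambda>x. f' x + g' x)"
      "f \<in> A" "g \<in> A" "\<forall>x\<in>K. f x = 0" "\<forall>x\<in>L. g x = 0"
      "f' \<in> A" "g' \<in> A" "\<forall>x\<in>K. f' x = 0" "\<forall>x\<in>L. g' x = 0" unfolding I_def by blast
    have "(\<lambda>x. u x + v x) = (\<lambda>x. (f x + f' x) + (g x + g' x))" by (simp add: *(1,2) algebra_simps)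
    also have "\<dots> \<in> I" using *(5,6,9,10) by (intro II in_A_add *(3,4,7,8)) auto
    finally show "(\<lambda>x. u x + v x) \<in> I" .
  next
    fix k u assume k: "k \<in> A" and "u \<in> I"
    then obtain f g where *: "u = (\<lambda>x. f x + g x)"
      "f \<in> A" "g \<in> A" "\<forall>x\<in>K. f x = 0" "\<forall>x\<in>L. g x = 0" unfolding I_def by blast
    have "(\<lambda>x. k x * u x) = (\<lambda>x. k x * f x + k x * g x)" by (simp add: *(1) algebra_simps)
    also have "\<dots> \<in> I" using *(4,5) by (intro II in_A_mult *(2,3) k) auto
    finally show "(\<lambda>x. k x * u x) \<in> I" .
  qed
  moreover have "\<exists>f\<in>I. f x \<noteq> 0" for x
  proof (cases "x \<in> K")
    case True
    with assms(3) have "x \<notin> L" by blast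
    from separate_point_closed[OF assms(2) this]
    obtain g where g: "g \<in> A" "g x = 1" "\<forall>y\<in>L. g y = 0" by blast
    then have "g \<in> I" using II[OF in_A_const[of 0] g(1)] by simp
    then show ?thesis by (rule bexI[rotated]) (simp add: g(2))
  next
    case False
    from separate_point_closed[OF assms(1) this]
    obtain f where f: "f \<in> A" "f x = 1" "\<forall>y\<in>K. f y = 0" by blast
    then have "f \<in> I" using II[OF f(1) in_A_const[of 0]] by simp
    then show ?thesis by (rule bexI[rotated]) (simp add: f(2))
  qed
  ultimately have "(\<lambda>x. 1) \<in> I" by (rule ideal_without_common_zero)
  then obtain f g where fg: "(\<lambda>x. 1) = (\<lambda>x. f x + g x)" "f \<in> A" "g \<in> A"
      "\<forall>x\<in>K. f x = 0" "\<forall>x\<in>L. g x = 0" unfolding I_def by blast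
  have "f x = 1" if "x \<in> L" for x using fun_cong[OF fg(1), of x] fg(5) that by simp
  with fg(2,4) show ?thesis by blast
qed

lemma closed_nbhd_between:
  fixes L U :: "'a set"
  assumes "closed L" "open U" "L \<subseteq> U"
  shows "\<exists>V. open V \<and> L \<subseteq> V \<and> closure V \<subseteq> U"
proof -
  have "compact_space (euclidean :: 'a topology)"
    using compact_UNIV by (simp add: compact_space_def)
  moreover have "Hausdorff_space (euclidean :: 'a topology)"
    unfolding Hausdorff_space_def disjnt_def using hausdorff by fastforce
  ultimately have "normal_space (euclidean :: 'a topology)"
    by (intro compact_Hausdorff_or_regular_imp_normal_space disjI1)
  then show ?thesis
    using assms unfolding normal_space_alt by simp
qed

text \<open>The values \<open>1\<close> and \<open>0\<close> are taken on open sets because locality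
  of \<open>T\<close> only detects agreement on a neighborhood.\<close>

lemma bump_function:
  assumes "open U" "x \<in> U"
  shows "\<exists>e\<in>A. (\<exists>V. open V \<and> x \<in> V \<and> (\<forall>y\<in>V. e y = 1)) \<and>
    (\<exists>W. open W \<and> - U \<subseteq> W \<and> (\<forall>y\<in>W. e y = 0))"
proof -
  obtain V where V: "open V" "x \<in> V" "closure V \<subseteq> U"
    using closed_nbhd_between[of "{x}" U] assms by auto
  obtain W where W: "open W" "- U \<subseteq> W" "closure W \<subseteq> - closure V"
    using closed_nbhd_between[of "- U" "- closure V"] assms V by auto
  obtain e where e: "e \<in> A" "\<forall>y\<in>closure W. e y = 0" "\<forall>y\<in>closure V. e y = 1"
    using separate_closed_sets[of "closure W" "closure V"] W(3) by blast
  then have "\<forall>y\<in>W. e y = 0" "\<forall>y\<in>V. e y = 1"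
    using closure_subset[of V] closure_subset[of W] by auto
  then show ?thesis
    using V(1,2) W(1,2) e(1) by blast
qed

text \<open>This replaces a partition of unity. The \<open>k\<close> with
  \<open>\<phi> (f * g * k) = 0\<close> for all \<open>g\<close> form an ideal; \<open>loc\<close>
  supplies a member that is nonzero at any given point, so \<open>1\<close> belongs to it.\<close>

lemma linear_functional_local:
  fixes \<phi> :: "('a \<Rightarrow> complex) \<Rightarrow> complex"
  assumes add: "\<And>f g. f \<in> A \<Longrightarrow> g \<in> A \<Longrightarrow> \<phi> (\<lambda>x. f x + g x) = \<phi> f + \<phi> g"
    and f: "f \<in> A"
    and loc: "\<And>x. \<exists>V. open V \<and> x \<in> V \<and> (\<forall>g\<in>A. coz g \<subseteq> V \<longrightarrow> \<phi> (\<lambda>x. f x * g x) = 0)"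
  shows "\<phi> f = 0"
proof -
  define I where "I = {k \<in> A. \<forall>g\<in>A. \<phi> (\<lambda>x. f x * (g x * k x)) = 0}"
  have "ideal_of I"
    unfolding ideal_of_def
  proof (intro conjI ballI)
    show "I \<subseteq> A" by (auto simp: I_def)
    have "\<phi> (\<lambda>x. 0) = 0" using add[of "\<lambda>x. 0" "\<lambda>x. 0"] in_A_const[of 0] by simp
    then show "(\<lambda>x. 0) \<in> I" using in_A_const[of 0] by (simp add: I_def)
    fix k l assume kl: "k \<in> I" "l \<in> I"
    then have kA: "k \<in> A" and lA: "l \<in> A" by (auto simp: I_def)
    have "\<phi> (\<lambda>x. f x * (g x * (k x + l x))) = 0" if g: "g \<in> A" for g
    proof -
      have "\<phi> (\<lambda>x. f x * (g x * k x) + f x * (g x * l x)) = 0"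
        using add[OF in_A_mult[OF f in_A_mult[OF g kA]] in_A_mult[OF f in_A_mult[OF g lA]]] kl g
        by (simp add: I_def)
      then show ?thesis by (simp add: distrib_left)
    qed
    then show "(\<lambda>x. k x + l x) \<in> I" using in_A_add[OF kA lA] by (simp add: I_def)
  next
    fix h k assume h: "h \<in> A" and k: "k \<in> I"
    then have kA: "k \<in> A" by (simp add: I_def)
    have "\<phi> (\<lambda>x. f x * (g x * (h x * k x))) = 0" if g: "g \<in> A" for g
    proof -
      have "\<phi> (\<lambda>x. f x * ((g x * h x) * k x)) = 0"
        using k in_A_mult[OF g h] by (simp add: I_def)
      then show ?thesis by (simp add: mult.assoc)
    qed
    then show "(\<lambda>x. h x * k x) \<in> I" using in_A_mult[OF h kA] by (simp add: I_def)
  qed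
  moreover have "\<exists>k\<in>I. k x \<noteq> 0" for x
  proof -
    obtain V where V: "open V" "x \<in> V" "\<And>g. g \<in> A \<Longrightarrow> coz g \<subseteq> V \<Longrightarrow> \<phi> (\<lambda>x. f x * g x) = 0"
      using loc[of x] by blast
    have "closed (- V)" "x \<notin> - V" using V by auto
    from separate_point_closed[OF this]
    obtain k where k: "k \<in> A" "k x = 1" "\<forall>y\<in>-V. k y = 0" by blast
    have "\<phi> (\<lambda>x. f x * (g x * k x)) = 0" if g: "g \<in> A" for g
    proof (rule V(3)[OF in_A_mult[OF g k(1)]])
      show "coz (\<lambda>x. g x * k x) \<subseteq> V" using k(3) by (auto simp: coz_def)
    qed
    then have "k \<in> I" using k(1) by (simp add: I_def)
    then show ?thesis by (rule bexI[rotated]) (simp add: k(2))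
  qed
  ultimately have "(\<lambda>x. 1) \<in> I" by (rule ideal_without_common_zero)
  then have "\<forall>g\<in>A. \<phi> (\<lambda>x. f x * g x) = 0" by (simp add: I_def)
  from bspec[OF this in_A_const[of 1]] show ?thesis by simp
qed

end

section \<open>Jointly separating maps\<close>

lemma complex_linear_map_add:
  "complex_linear_map A B T \<Longrightarrow> f \<in> A \<Longrightarrow> g \<in> A \<Longrightarrow> T (\<lambda>x. f x + g x) = (\<lambda>y. T f y + T g y)"
  and complex_linear_map_cmult:
  "complex_linear_map A B T \<Longrightarrow> f \<in> A \<Longrightarrow> T (\<lambda>x. c * f x) = (\<lambda>y. c * T f y)"
  and complex_linear_map_in: "complex_linear_map A B T \<Longrightarrow> f \<in> A \<Longrightarrow> T f \<in> B"
  unfolding complex_linear_map_def by auto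

section \<open>Supports of functionals\<close>

context regular_compact_banach_function_algebra
begin

text \<open>Support in the sense of distributions, meaningful without continuity of
  \<open>\<phi>\<close>.\<close>

definition in_support :: "(('a \<Rightarrow> complex) \<Rightarrow> complex) \<Rightarrow> 'a \<Rightarrow> bool" where
  "in_support \<phi> x \<longleftrightarrow> (\<forall>V. open V \<longrightarrow> x \<in> V \<longrightarrow> (\<exists>g\<in>A. coz g \<subseteq> V \<and> \<phi> g \<noteq> 0))"

lemma support_nonempty:
  fixes \<phi> :: "('a \<Rightarrow> complex) \<Rightarrow> complex"
  assumes add: "\<And>f g. f \<in> A \<Longrightarrow> g \<in> A \<Longrightarrow> \<phi> (\<lambda>x. f x + g x) = \<phi> f + \<phi> g"
    and f: "f \<in> A" "\<phi> f \<noteq> 0"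
  shows "\<exists>x. in_support \<phi> x"
proof (rule ccontr)
  assume none: "\<not> ?thesis"
  have "\<phi> f = 0"
  proof (rule linear_functional_local[where \<phi> = \<phi>, OF add f(1)])
    fix x
    have "\<not> in_support \<phi> x" using none by simp
    then obtain V where V: "open V" "x \<in> V" "\<forall>g\<in>A. coz g \<subseteq> V \<longrightarrow> \<phi> g = 0"
      unfolding in_support_def by fastforce
    have "\<phi> (\<lambda>x. f x * g x) = 0" if g: "g \<in> A" "coz g \<subseteq> V" for g
    proof -
      have "coz (\<lambda>x. f x * g x) \<subseteq> V" using g(2) by (auto simp: coz_def)
      from mp[OF bspec[OF V(3) in_A_mult[OF f(1) g(1)]] this] show ?thesis .
    qed
    then show "\<exists>V. open V \<and> x \<in> V \<and> (\<forall>g\<in>A. coz g \<subseteq> V \<longrightarrow> \<phi> (\<lambda>x. f x * g x) = 0)"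
      by (intro exI[of _ V] conjI ballI impI V(1,2))
  qed
  with f(2) show False by simp
qed

text \<open>Near \<open>x\<close> the products \<open>f * g\<close> are zero, and any other point is
  off the support and has a neighborhood on which \<open>\<phi>\<close> vanishes.
  \<open>linear_functional_local\<close> combines the two.\<close>

lemma vanishing_near_support:
  fixes \<phi> :: "('a \<Rightarrow> complex) \<Rightarrow> complex"
  assumes add: "\<And>f g. f \<in> A \<Longrightarrow> g \<in> A \<Longrightarrow> \<phi> (\<lambda>x. f x + g x) = \<phi> f + \<phi> g"
    and supp: "\<And>z. in_support \<phi> z \<Longrightarrow> z = x"
    and f: "f \<in> A" and U: "open U" "x \<in> U" "\<forall>z\<in>U. f z = 0"
  shows "\<phi> f = 0"
proof (rule linear_functional_local[where \<phi> = \<phi>, OF add f])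
  fix z
  show "\<exists>V. open V \<and> z \<in> V \<and> (\<forall>g\<in>A. coz g \<subseteq> V \<longrightarrow> \<phi> (\<lambda>x. f x * g x) = 0)"
  proof (cases "z = x")
    case True
    have zero: "\<phi> (\<lambda>x. 0) = 0" using add[OF in_A_const[of 0] in_A_const[of 0]] by simp
    have "\<phi> (\<lambda>x. f x * g x) = 0" if "coz g \<subseteq> U" for g
    proof -
      have "(\<lambda>x. f x * g x) = (\<lambda>x. 0)" using that U(3) by (auto simp: coz_def fun_eq_iff)
      then show ?thesis by (simp only: zero)
    qed
    then show ?thesis using U(2) by (intro exI[of _ U] conjI ballI impI U(1)) (simp_all only: True)
  next
    case False
    then have "\<not> in_support \<phi> z" using supp by blast
    then obtain V where V: "open V" "z \<in> V" "\<forall>g\<in>A. coz g \<subseteq> V \<longrightarrow> \<phi> g = 0"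
      unfolding in_support_def by fastforce
    have "\<phi> (\<lambda>x. f x * g x) = 0" if g: "g \<in> A" "coz g \<subseteq> V" for g
    proof -
      have "coz (\<lambda>x. f x * g x) \<subseteq> V" using g(2) by (auto simp: coz_def)
      from mp[OF bspec[OF V(3) in_A_mult[OF f g(1)]] this] show ?thesis .
    qed
    then show ?thesis by (intro exI[of _ V] conjI ballI impI V(1,2))
  qed
qed

text \<open>Distinct points in the two supports would have disjoint neighborhoods, and functions
  supported there would contradict \<open>sep\<close>. So each point of one support equals each
  point of the other; both are nonempty, hence the same singleton.\<close>

lemma common_support_point:
  fixes \<phi> \<psi> :: "('a \<Rightarrow> complex) \<Rightarrow> complex"
  assumes add\<phi>: "\<And>f g. f \<in> A \<Longrightarrow> g \<in> A \<Longrightarrow> \<phi> (\<lambda>x. f x + g x) = \<phi> f + \<phi> g"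
    and add\<psi>: "\<And>f g. f \<in> A \<Longrightarrow> g \<in> A \<Longrightarrow> \<psi> (\<lambda>x. f x + g x) = \<psi> f + \<psi> g"
    and nz: "f0 \<in> A" "\<phi> f0 \<noteq> 0" "g0 \<in> A" "\<psi> g0 \<noteq> 0"
    and sep: "\<And>f g. f \<in> A \<Longrightarrow> g \<in> A \<Longrightarrow> coz f \<inter> coz g = {} \<Longrightarrow> \<phi> f = 0 \<or> \<psi> g = 0"
  shows "\<exists>x. \<forall>f\<in>A. (\<exists>U. open U \<and> x \<in> U \<and> (\<forall>z\<in>U. f z = 0)) \<longrightarrow> \<phi> f = 0 \<and> \<psi> f = 0"
proof -
  have eq: "x = z" if x: "in_support \<phi> x" and z: "in_support \<psi> z" for x z
  proof (rule ccontr)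
    assume "x \<noteq> z"
    from hausdorff[OF this]
    obtain V W where VW: "open V" "open W" "x \<in> V" "z \<in> W" "V \<inter> W = {}" by blast
    have "\<exists>f\<in>A. coz f \<subseteq> V \<and> \<phi> f \<noteq> 0" "\<exists>g\<in>A. coz g \<subseteq> W \<and> \<psi> g \<noteq> 0"
      using x z VW by (simp_all add: in_support_def)
    then obtain f g where f: "f \<in> A" "coz f \<subseteq> V" "\<phi> f \<noteq> 0" and g: "g \<in> A" "coz g \<subseteq> W" "\<psi> g \<noteq> 0"
      by (elim bexE conjE)
    have "coz f \<inter> coz g = {}" using f(2) g(2) VW(5) by blast
    with sep[OF f(1) g(1)] f(3) g(3) show False by simp
  qed
  obtain x where x: "in_support \<phi> x"
    using support_nonempty[where \<phi> = \<phi>, OF add\<phi> nz(1,2)] by (rule exE)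
  obtain z where z: "in_support \<psi> z"
    using support_nonempty[where \<phi> = \<psi>, OF add\<psi> nz(3,4)] by (rule exE)
  have supp\<phi>: "w = x" if "in_support \<phi> w" for w
    using eq[OF that z] eq[OF x z] by simp
  have supp\<psi>: "w = x" if "in_support \<psi> w" for w
    using eq[OF x that] by simp
  have "\<phi> f = 0 \<and> \<psi> f = 0"
    if f: "f \<in> A" and U: "open U" "x \<in> U" "\<forall>z\<in>U. f z = 0" for f U
  proof
    show "\<phi> f = 0" by (rule vanishing_near_support[where \<phi> = \<phi>, OF add\<phi> supp\<phi> f U])
    show "\<psi> f = 0" by (rule vanishing_near_support[where \<phi> = \<psi>, OF add\<psi> supp\<psi> f U])
  qed
  then show ?thesis by (intro exI[of _ x] ballI impI) (elim exE conjE)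
qed

end

text \<open>What joint separation leaves for a single map: \<open>T f y\<close> depends only on the
  germ of \<open>f\<close> at \<open>h y\<close>. Stated for one map so that \<open>T\<close> and
  \<open>S\<close> share the argument.\<close>

locale local_bijection = regular_compact_banach_function_algebra A N
  for A :: "('a::t2_space \<Rightarrow> complex) set" and N +
  fixes B :: "('b::t2_space \<Rightarrow> complex) set" and T :: "('a \<Rightarrow> complex) \<Rightarrow> ('b \<Rightarrow> complex)"
    and h :: "'b \<Rightarrow> 'a"
  assumes property_P: "property_P A N"
    and compact_UNIV': "compact (UNIV :: 'b set)"
    and B: "function_algebra B"
    and linear: "complex_linear_map A B T"
    and bij: "bij_betw T A B"
    and local: "\<And>f y U. f \<in> A \<Longrightarrow> open U \<Longrightarrow> h y \<in> U \<Longrightarrow> \<forall>x\<in>U. f x = 0 \<Longrightarrow> T f y = 0"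
begin

lemmas T_add = complex_linear_map_add[OF linear]
  and T_cmult = complex_linear_map_cmult[OF linear]
  and T_in_B = complex_linear_map_in[OF linear]

lemma T_diff: "f \<in> A \<Longrightarrow> g \<in> A \<Longrightarrow> T (\<lambda>x. f x - g x) = (\<lambda>y. T f y - T g y)"
  using T_add[OF _ in_A_cmult[of g "-1"], of f] T_cmult[of g "-1"] by simp

lemma T_zero: "T (\<lambda>x. 0) = (\<lambda>y. 0)"
  using T_cmult[OF in_A_const[of 0], of 0] by simp

lemma T_eq_0: "f \<in> A \<Longrightarrow> T f = (\<lambda>y. 0) \<Longrightarrow> f = (\<lambda>x. 0)"
  by (rule inj_onD[OF bij_betw_imp_inj_on[OF bij] _ _ in_A_const]) (simp_all add: T_zero)

lemma T_surj: "b \<in> B \<Longrightarrow> \<exists>f\<in>A. T f = b"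
  using bij_betw_imp_surj_on[OF bij] by blast

lemma T_continuous: "f \<in> A \<Longrightarrow> continuous_on UNIV (T f)"
  using T_in_B B unfolding function_algebra_def by auto

lemma B_const: "(\<lambda>y. c) \<in> B"
  and B_mult: "b \<in> B \<Longrightarrow> b' \<in> B \<Longrightarrow> (\<lambda>y. b y * b' y) \<in> B"
  and B_separates: "y \<noteq> z \<Longrightarrow> \<exists>b\<in>B. b y \<noteq> b z"
  using B unfolding function_algebra_def by auto

lemma T_cong:
  assumes "f \<in> A" "g \<in> A" "open U" "h y \<in> U" "\<forall>x\<in>U. f x = g x"
  shows "T f y = T g y"
proof -
  have "T (\<lambda>x. f x - g x) y = 0"
    using assms by (intro local[OF in_A_diff]) auto
  then show ?thesis by (simp add: T_diff assms)
qed

lemma T_nonzero: "\<exists>f\<in>A. T f y = 1"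
proof -
  obtain f where "f \<in> A" "T f = (\<lambda>y. 1)" using T_surj[OF B_const] by blast
  then show ?thesis by (intro bexI[of _ f]) simp_all
qed

text \<open>Cutting off \<open>f\<close> by a bump gives \<open>g\<close> that vanishes near the
  complement of \<open>U\<close> while \<open>T g y0 = 1\<close>. The open set where
  \<open>T g\<close> is nonzero then lies in the preimage of \<open>U\<close>.\<close>

lemma h_continuous: "continuous_on UNIV h"
proof -
  have "open (h -` U)" if U: "open U" for U
  proof (subst open_subopen, intro ballI)
    fix y0 assume "y0 \<in> h -` U"
    then have y0: "h y0 \<in> U" by simp
    obtain e V W where e: "e \<in> A" and V: "open V" "h y0 \<in> V" "\<forall>x\<in>V. e x = 1"
      and W: "open W" "- U \<subseteq> W" "\<forall>x\<in>W. e x = 0"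
      using bump_function[OF U y0] by blast
    obtain f where f: "f \<in> A" "T f y0 = 1" using T_nonzero by blast
    define g where "g = (\<lambda>x. f x * e x)"
    have g: "g \<in> A" unfolding g_def by (rule in_A_mult[OF f(1) e])
    have "T g y0 = T f y0"
      using V by (intro T_cong[OF g f(1) V(1,2)]) (simp add: g_def)
    then have "T g y0 \<noteq> 0" using f(2) by simp
    moreover have "T g y = 0" if "h y \<notin> U" for y
      using W that by (intro local[OF g W(1)]) (auto simp: g_def)
    moreover have "open (T g -` (- {0}))"
      by (intro open_vimage T_continuous g) auto
    ultimately show "\<exists>Z. open Z \<and> y0 \<in> Z \<and> Z \<subseteq> h -` U"
      by (intro exI[of _ "T g -` (- {0})"]) auto
  qed
  then show ?thesis by (simp add: continuous_on_open_vimage)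
qed

lemma closed_image_h: "closed C \<Longrightarrow> closed (h ` C)"
  using compact_Int_closed[OF compact_UNIV', of C] h_continuous
  by (metis Int_UNIV_left compact_continuous_image compact_imp_closed continuous_on_subset subset_UNIV)

text \<open>A bump supported off the closed range of \<open>h\<close> vanishes near every
  \<open>h y\<close>, so \<open>T\<close> would annihilate it, against injectivity.\<close>

lemma h_surj: "range h = UNIV"
proof (rule ccontr)
  assume "range h \<noteq> UNIV"
  then obtain x where x: "x \<in> - range h" by blast
  have "open (- range h)" using closed_image_h[OF closed_UNIV] by (simp add: open_Compl)
  from bump_function[OF this x]
  obtain e V W where e: "e \<in> A" and V: "x \<in> V" "\<forall>x\<in>V. e x = 1"
    and W: "open W" "range h \<subseteq> W" "\<forall>x\<in>W. e x = 0"
    by auto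
  have "T e = (\<lambda>y. 0)"
  proof
    show "T e y = 0" for y using W(2) by (intro local[OF e W(1) _ W(3)]) blast
  qed
  from T_eq_0[OF e this] V show False by simp
qed

section \<open>Regular points and the gliding hump\<close>

definition regular_points :: "'b set" where
  "regular_points = {y. \<forall>f\<in>A. T f y = T (\<lambda>x. 1) y * f (h y)}"

lemma regular_pointsD: "y \<in> regular_points \<Longrightarrow> f \<in> A \<Longrightarrow> T f y = T (\<lambda>x. 1) y * f (h y)"
  by (simp add: regular_points_def)

text \<open>Writing regularity as an equation makes the set an intersection of equalizers of
  continuous functions.\<close>

lemma closed_regular_points: "closed regular_points"
proof -
  have "closed {y. T f y = T (\<lambda>x. 1) y * f (h y)}" if f: "f \<in> A" for f
  proof (rule closed_Collect_eq)
    show "continuous_on UNIV (\<lambda>y. T (\<lambda>x. 1) y * f (h y))"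
      by (intro continuous_on_mult T_continuous in_A_const
          continuous_on_compose2[OF in_A_continuous[OF f] h_continuous]) auto
  qed (rule T_continuous[OF f])
  moreover have "regular_points = (\<Inter>f\<in>A. {y. T f y = T (\<lambda>x. 1) y * f (h y)})"
    by (auto simp: regular_points_def)
  ultimately show ?thesis by (simp add: closed_INT)
qed

text \<open>Subtracting from \<open>f\<close> its value at \<open>h y\<close> turns a failure of the
  formula into a function that vanishes at \<open>h y\<close> while its image does not vanish at
  \<open>y\<close>.\<close>

lemma irregular_point:
  assumes "y \<notin> regular_points"
  shows "\<exists>g\<in>A. g (h y) = 0 \<and> T g y \<noteq> 0"
proof -
  obtain f where f: "f \<in> A" "T f y \<noteq> T (\<lambda>x. 1) y * f (h y)"
    using assms unfolding regular_points_def by blast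
  define g where "g = (\<lambda>x. f x - f (h y) * 1)"
  have g: "g \<in> A" unfolding g_def by (intro in_A_diff in_A_const f)
  have "T g y = T f y - f (h y) * T (\<lambda>x. 1) y"
    unfolding g_def T_diff[OF f(1) in_A_cmult[OF in_A_const]] T_cmult[OF in_A_const] ..
  with f(2) have "T g y \<noteq> 0" by (simp add: mult.commute)
  with g show ?thesis by (intro bexI[of _ g]) (simp_all add: g_def)
qed

text \<open>At an isolated point, vanishing at \<open>h y\<close> already is vanishing near it, so
  \<open>local\<close> applies.\<close>

lemma isolated_regular:
  assumes "open {h y}" shows "y \<in> regular_points"
proof (rule ccontr)
  assume "y \<notin> regular_points"
  then obtain g where g: "g \<in> A" "g (h y) = 0" "T g y \<noteq> 0" using irregular_point by blast
  have "T g y = 0" using g(2) by (intro local[OF g(1) assms]) simp_all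
  with g(3) show False by simp
qed

text \<open>Property (P) approximates \<open>g\<close> by functions \<open>F n\<close> with
  \<open>T (F n) y = 0\<close>. Thus \<open>F n - g\<close> tends to \<open>0\<close> while its
  image at \<open>y\<close> stays \<open>- T g y\<close>: a discontinuity that can be rescaled, and
  localized to \<open>V\<close> by a bump.\<close>

lemma irregular_point_small_function:
  assumes y: "y \<notin> regular_points" and V: "open V" "h y \<in> V" and "0 < \<epsilon>" "0 \<le> K"
  shows "\<exists>g\<in>A. N g \<le> \<epsilon> \<and> coz g \<subseteq> V \<and> cmod (T g y) = K"
proof -
  obtain g where g: "g \<in> A" "g (h y) = 0" "T g y \<noteq> 0" using irregular_point[OF y] by blast
  from property_P[unfolded property_P_def, rule_format, OF g(1,2)]
  obtain F where F: "\<forall>n. F n \<in> A \<and> (\<exists>U. open U \<and> h y \<in> U \<and> (\<forall>x\<in>U. F n x = 0))"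
    and lim: "(\<lambda>n. N (\<lambda>x. F n x - g x)) \<longlonglongrightarrow> 0"
    by (elim exE conjE)
  have FA: "F n \<in> A" for n using F by simp
  obtain e U W where e: "e \<in> A" and U: "open U" "h y \<in> U" "\<forall>x\<in>U. e x = 1"
      and W: "- V \<subseteq> W" "\<forall>x\<in>W. e x = 0"
    using bump_function[OF V] by blast
  \<comment> \<open>This factor gives \<open>c * T g y\<close> modulus exactly \<open>K\<close>. It
    does not depend on \<open>n\<close>, so a large \<open>n\<close> still makes the norm
    small.\<close>
  define c where "c = complex_of_real (K / cmod (T g y))"
  define k where "k = (\<lambda>n x. c * (e x * (F n x - g x)))"
  have dA: "(\<lambda>x. F n x - g x) \<in> A" for n by (rule in_A_diff[OF FA g(1)])
  have edA: "(\<lambda>x. e x * (F n x - g x)) \<in> A" for n by (rule in_A_mult[OF e dA])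
  have kA: "k n \<in> A" for n unfolding k_def by (rule in_A_cmult[OF edA])
  have "T (k n) y = - (c * T g y)" for n
  proof -
    have "T (\<lambda>x. e x * (F n x - g x)) y = T (\<lambda>x. F n x - g x) y"
      using U(3) by (intro T_cong[OF edA dA U(1,2)]) simp
    also have "\<dots> = T (F n) y - T g y" by (simp add: T_diff FA g(1))
    also have "T (F n) y = 0"
    proof -
      obtain U where "open U" "h y \<in> U" "\<forall>x\<in>U. F n x = 0" using F by blast
      then show ?thesis by (rule local[OF FA])
    qed
    finally show ?thesis unfolding k_def T_cmult[OF edA] by simp
  qed
  moreover have "cmod (c * T g y) = K"
    using g(3) assms(5) by (simp add: c_def norm_mult norm_divide)
  ultimately have Tk: "cmod (T (k n) y) = K" for n by simp
  have "(\<lambda>n. cmod c * (N e * N (\<lambda>x. F n x - g x))) \<longlonglongrightarrow> 0"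
    by (intro tendsto_mult_right_zero lim)
  from order_tendstoD(2)[OF this \<open>0 < \<epsilon>\<close>]
  obtain n where n: "cmod c * (N e * N (\<lambda>x. F n x - g x)) < \<epsilon>"
    by (auto simp: eventually_sequentially)
  have "N (k n) \<le> cmod c * (N e * N (\<lambda>x. F n x - g x))"
    unfolding k_def norm_cmult[OF edA] by (intro mult_left_mono norm_mult_le e dA norm_ge_zero)
  with n have "N (k n) \<le> \<epsilon>" by simp
  moreover have "coz (k n) \<subseteq> V" using W by (auto simp: coz_def k_def)
  ultimately show ?thesis using kA Tk by blast
qed

text \<open>Isolated points of \<open>X\<close> are images of regular points, so \<open>W\<close>
  has two points, which Hausdorff separation splits: \<open>V\<close> carries a hump and
  \<open>W'\<close> leaves room for the next ones.\<close>

lemma open_meets_twice: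
  assumes W: "open W" "W \<noteq> {}" "W \<subseteq> - h ` regular_points"
  shows "\<exists>y V W'. open V \<and> h y \<in> V \<and> V \<subseteq> W \<and> open W' \<and> W' \<noteq> {} \<and> W' \<subseteq> W \<and> V \<inter> W' = {}"
proof -
  obtain x where x: "x \<in> W" using W(2) by blast
  obtain y where y: "h y = x" using h_surj by (metis UNIV_I imageE)
  have "y \<notin> regular_points" using W(3) x y by blast
  then have "\<not> open {x}" using isolated_regular[of y] y by blast
  with W(1) have "W \<noteq> {x}" by blast
  with x obtain z where z: "z \<in> W" "x \<noteq> z" by blast
  from hausdorff[OF z(2)] obtain U U' where U: "open U" "open U'" "x \<in> U" "z \<in> U'" "U \<inter> U' = {}"
    by blast
  show ?thesis
  proof (intro exI conjI)
    show "open (U \<inter> W)" "open (U' \<inter> W)" using U W by auto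
    show "h y \<in> U \<inter> W" using y U x by simp
    show "U' \<inter> W \<noteq> {}" using U z by blast
    show "(U \<inter> W) \<inter> (U' \<inter> W) = {}" using U by blast
  qed auto
qed

text \<open>Dependent choice on triples \<open>(y, V, W)\<close>: all later sets are taken inside
  \<open>W\<close>, which is disjoint from \<open>V\<close>.\<close>

lemma disjoint_open_sequence:
  assumes "h ` regular_points \<noteq> UNIV"
  shows "\<exists>y V. (\<forall>n::nat. y n \<notin> regular_points \<and> open (V n) \<and> h (y n) \<in> V n) \<and>
    (\<forall>m n. m \<noteq> n \<longrightarrow> V m \<inter> V n = {})"
proof -
  let ?U = "- h ` regular_points"
  define P where "P = (\<lambda>(y, V, W). open V \<and> h y \<in> V \<and> V \<subseteq> ?U \<and> open W \<and> W \<noteq> {} \<and> W \<subseteq> ?U \<and> V \<inter> W = {})"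
  define Q where "Q = (\<lambda>(y :: 'b, V :: 'a set, W) (y' :: 'b, V', W'). V' \<subseteq> W \<and> W' \<subseteq> (W :: 'a set))"
  have step: "\<exists>s. P s \<and> fst (snd s) \<subseteq> W \<and> snd (snd s) \<subseteq> W" if W: "open W" "W \<noteq> {}" "W \<subseteq> ?U" for W
  proof -
    obtain y V W' where "open V" "h y \<in> V" "V \<subseteq> W" "open W'" "W' \<noteq> {}" "W' \<subseteq> W" "V \<inter> W' = {}"
      using open_meets_twice[OF W] by blast
    with W(3) show ?thesis by (intro exI[of _ "(y, V, W')"]) (auto simp: P_def)
  qed
  have "open ?U" using closed_image_h[OF closed_regular_points] by (simp add: open_Compl)
  with assms have base: "\<exists>s. P s" using step[of ?U] by blast
  have ind: "\<exists>s'. P s' \<and> Q s s'" if "P s" for s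
  proof (cases s)
    case (fields y V W)
    with that have "open W" "W \<noteq> {}" "W \<subseteq> ?U" by (simp_all add: P_def)
    from step[OF this] show ?thesis unfolding fields Q_def by (simp add: case_prod_beta)
  qed
  obtain s where s: "\<And>n::nat. P (s n)" "\<And>n. Q (s n) (s (Suc n))"
    using dependent_nat_choice[of "\<lambda>_. P" "\<lambda>_. Q"] base ind by metis
  define y V W where "y = (\<lambda>n. fst (s n))" and "V = (\<lambda>n. fst (snd (s n)))"
    and "W = (\<lambda>n. snd (snd (s n)))"
  have props: "open (V n)" "h (y n) \<in> V n" "V n \<subseteq> ?U" "V n \<inter> W n = {}"
    "V (Suc n) \<subseteq> W n" "W (Suc n) \<subseteq> W n" for n
    using s[of n] by (auto simp: P_def Q_def case_prod_beta y_def V_def W_def)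
  have "decseq W" using props(6) by (rule decseq_SucI)
  have disj: "V m \<inter> V n = {}" if mn: "m < n" for m n
  proof -
    obtain k where k: "n = Suc k" "m \<le> k" using mn by (cases n) auto
    have "V n \<subseteq> W m" using props(5)[of k] decseqD[OF \<open>decseq W\<close> k(2)] k(1) by blast
    with props(4)[of m] show ?thesis by blast
  qed
  have "V m \<inter> V n = {}" if "m \<noteq> n" for m n
    using disj[of m n] disj[of n m] that by (cases "m < n") (auto simp: Int_commute)
  moreover have "y n \<notin> regular_points" for n using props(2,3)[of n] by blast
  ultimately show ?thesis using props(1,2) by (intro exI[of _ y] exI[of _ V]) simp
qed

text \<open>A gliding hump: otherwise a norm-convergent series of functions with disjoint cozero sets
  is mapped to an unbounded function.\<close>

lemma regular_points_cover: "h ` regular_points = UNIV"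
proof (rule ccontr)
  assume "h ` regular_points \<noteq> UNIV"
  from disjoint_open_sequence[OF this] obtain y V
    where y: "\<forall>n::nat. y n \<notin> regular_points \<and> open (V n) \<and> h (y n) \<in> V n"
      and disj: "\<forall>m n. m \<noteq> n \<longrightarrow> V m \<inter> V n = {}" by blast
  \<comment> \<open>The bound \<open>(1/2) ^ n\<close> makes the series converge, and the value
    \<open>real n\<close> makes the image of its sum unbounded.\<close>
  have "\<forall>n. \<exists>g. g \<in> A \<and> N g \<le> (1/2) ^ n \<and> coz g \<subseteq> V n \<and> cmod (T g (y n)) = real n"
  proof
    fix n
    have "\<exists>g\<in>A. N g \<le> (1/2) ^ n \<and> coz g \<subseteq> V n \<and> cmod (T g (y n)) = real n"
      using y by (intro irregular_point_small_function) auto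
    then show "\<exists>g. g \<in> A \<and> N g \<le> (1/2) ^ n \<and> coz g \<subseteq> V n \<and> cmod (T g (y n)) = real n" by blast
  qed
  from choice[OF this] obtain g where
    g: "\<forall>n. g n \<in> A \<and> N (g n) \<le> (1/2) ^ n \<and> coz (g n) \<subseteq> V n \<and> cmod (T (g n) (y n)) = real n" by blast
  have gA: "g n \<in> A" for n using g by simp
  have "summable (\<lambda>n. N (g n))"
  proof (rule summable_comparison_test')
    show "summable (\<lambda>n. (1/2 :: real) ^ n)" by (simp add: summable_geometric)
    show "norm (N (g n)) \<le> (1/2) ^ n" for n using g norm_nonneg[OF gA] by simp
  qed
  from absolutely_convergent_series[OF gA this]
  obtain f where f: "f \<in> A" and lim: "(\<lambda>n. N (\<lambda>x. (\<Sum>k<n. g k x) - f x)) \<longlonglongrightarrow> 0" by blast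
  \<comment> \<open>Evaluations are bounded by \<open>N\<close>, so the sum may be computed
    pointwise; on \<open>V n\<close> only the term \<open>g n\<close> is nonzero.\<close>
  have eq: "f x = g n x" if x: "x \<in> V n" for x n
  proof -
    have zero: "g k x = 0" if "k \<noteq> n" for k
    proof -
      have "x \<notin> V k" using disj that x by blast
      then show ?thesis using g by (auto simp: coz_def)
    qed
    have "(\<lambda>m. (\<Sum>k<m. g k x) - f x) \<longlonglongrightarrow> 0"
    proof (rule Lim_null_comparison[OF always_eventually lim], rule allI)
      show "norm ((\<Sum>k<m. g k x) - f x) \<le> N (\<lambda>x. (\<Sum>k<m. g k x) - f x)" for m
        using norm_evaluation_le[OF in_A_diff[OF in_A_sum[of "{..<m}" g] f]] gA by blast
    qed
    moreover have "\<forall>\<^sub>F m in sequentially. (\<Sum>k<m. g k x) - f x = g n x - f x"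
      using eventually_gt_at_top[of n]
    proof eventually_elim
      case (elim m)
      have "(\<Sum>k<m. g k x) = (\<Sum>k\<in>{n}. g k x)"
        using elim zero by (intro sum.mono_neutral_right) auto
      then show ?case by simp
    qed
    ultimately have "(\<lambda>m. g n x - f x) \<longlonglongrightarrow> 0" by (rule Lim_transform_eventually)
    then show ?thesis by (simp add: LIMSEQ_const_iff)
  qed
  \<comment> \<open>\<open>T\<close> cannot be exchanged with the infinite sum; instead
    \<open>f\<close> and \<open>g n\<close> agree near \<open>h (y n)\<close>, and locality gives
    the value.\<close>
  have unbounded: "cmod (T f (y n)) = real n" for n
  proof -
    have "T f (y n) = T (g n) (y n)"
      using y eq by (intro T_cong[OF f gA, where U = "V n"]) auto
    then show ?thesis using g by simp
  qed
  have "bounded (range (T f))"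
    by (intro compact_imp_bounded compact_continuous_image T_continuous f compact_UNIV')
  then obtain K where K: "\<And>z. cmod (T f z) \<le> K" unfolding bounded_iff by blast
  obtain n where "K < real n" using reals_Archimedean2 by blast
  with K[of "y n"] unbounded[of n] show False by simp
qed

text \<open>Restriction to the regular points identifies \<open>B\<close> with \<open>A\<close> as an algebra, so a point of \<open>Y\<close>
  induces a character of \<open>A\<close>, which is an evaluation.\<close>

lemma regular_points_UNIV: "regular_points = UNIV"
proof -
  \<comment> \<open>The weight \<open>T 1\<close> is nonzero at regular points, and these lie over
    every point of \<open>X\<close>, so the values of \<open>T f\<close> there recover
    \<open>f\<close>.\<close>
  have T_eq: "T f = T g" if fg: "f \<in> A" "g \<in> A" and eq: "\<And>y. y \<in> regular_points \<Longrightarrow> T f y = T g y" for f g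
  proof -
    have "f x = g x" for x
    proof -
      obtain y where y: "y \<in> regular_points" "h y = x" using regular_points_cover by (metis UNIV_I imageE)
      obtain k where "k \<in> A" "T k y = 1" using T_nonzero by blast
      then have "T (\<lambda>x. 1) y \<noteq> 0" using regular_pointsD[OF y(1), of k] by auto
      then show ?thesis using eq[OF y(1)] fg y by (simp add: regular_pointsD)
    qed
    then have "f = g" by (rule ext)
    then show ?thesis by simp
  qed
  \<comment> \<open>At regular points \<open>u \<circ> h\<close> is the reciprocal of
    \<open>T 1\<close>; multiplication by \<open>u\<close> removes the weight.\<close>
  obtain u where u: "u \<in> A" "T u = (\<lambda>y. 1)" using T_surj[OF B_const] by blast
  have T1: "T (\<lambda>x. 1) y * u (h y) = 1" if "y \<in> regular_points" for y
    using regular_pointsD[OF that u(1)] u(2) by simp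
  have uA: "(\<lambda>x. f x * u x) \<in> A" if "f \<in> A" for f using that u(1) by (rule in_A_mult)
  have Tu: "T (\<lambda>x. f x * u x) y = f (h y)" if "f \<in> A" "y \<in> regular_points" for f y
    using regular_pointsD[OF that(2) uA[OF that(1)]] T1[OF that(2)] by (simp add: algebra_simps)
  \<comment> \<open>The opposite of \<open>u\<close>: \<open>w \<circ> h = T 1\<close> at regular
    points, so \<open>T (k * w * u) = T k\<close> there, and by \<open>T_eq\<close>
    everywhere.\<close>
  obtain w where w: "w \<in> A" "T w = (\<lambda>y. T (\<lambda>x. 1) y * T (\<lambda>x. 1) y)"
    using T_surj[OF B_mult[OF T_in_B[OF in_A_const] T_in_B[OF in_A_const]]] by blast
  have wh: "w (h y) = T (\<lambda>x. 1) y" if "y \<in> regular_points" for y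
    using regular_pointsD[OF that w(1)] T1[OF that] w(2) by auto
  have "y0 \<in> regular_points" for y0
  proof -
    \<comment> \<open>Multiplicativity at \<open>y0\<close> is inherited:
      \<open>T (f * g * u)\<close> and the product of \<open>T (f * u)\<close> and
      \<open>T (g * u)\<close> agree at regular points, both are images under \<open>T\<close>, and
      \<open>T_eq\<close> makes them equal.\<close>
    define \<xi> where "\<xi> = restrict (\<lambda>f. T (\<lambda>x. f x * u x) y0) A"
    have \<xi>: "\<xi> f = T (\<lambda>x. f x * u x) y0" if "f \<in> A" for f using that by (simp add: \<xi>_def)
    have "\<xi> \<in> characters A"
      unfolding characters_def
    proof (intro CollectI conjI ballI allI)
      show "\<xi> \<in> extensional A" by (simp add: \<xi>_def)
      have "\<xi> (\<lambda>x. 1) = 1" using u by (simp add: \<xi>[OF in_A_const])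
      then show "\<exists>f\<in>A. \<xi> f \<noteq> 0" by (intro bexI[OF _ in_A_const[of 1]]) simp
      fix f assume f: "f \<in> A"
      show "\<xi> (\<lambda>x. c * f x) = c * \<xi> f" for c
        using T_cmult[OF uA[OF f], of c] by (simp add: \<xi> f in_A_cmult mult.assoc)
      fix g assume g: "g \<in> A"
      show "\<xi> (\<lambda>x. f x + g x) = \<xi> f + \<xi> g"
        using T_add[OF uA[OF f] uA[OF g]] by (simp add: \<xi> f g in_A_add distrib_right)
      obtain k where k: "k \<in> A" "T k = (\<lambda>y. T (\<lambda>x. f x * u x) y * T (\<lambda>x. g x * u x) y)"
        using T_surj[OF B_mult[OF T_in_B[OF uA[OF f]] T_in_B[OF uA[OF g]]]] by blast
      have "T (\<lambda>x. f x * g x * u x) = T k"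
      proof (rule T_eq[OF uA[OF in_A_mult[OF f g]] k(1)])
        show "T (\<lambda>x. f x * g x * u x) y = T k y" if "y \<in> regular_points" for y
          using Tu[OF in_A_mult[OF f g] that] by (simp add: k(2) Tu f g that)
      qed
      then show "\<xi> (\<lambda>x. f x * g x) = \<xi> f * \<xi> g"
        by (simp add: \<xi> f g in_A_mult k(2))
    qed
    then obtain x where x: "\<forall>f\<in>A. \<xi> f = f x" using character_is_evaluation by blast
    obtain y where y: "y \<in> regular_points" "h y = x" using regular_points_cover by (metis UNIV_I imageE)
    \<comment> \<open>With \<open>T k = b\<close>, both values equal \<open>k x * w x\<close>: at
      \<open>y0\<close> because \<open>\<xi>\<close> is evaluation at \<open>x\<close>, at
      \<open>y\<close> by regularity. So \<open>B\<close> cannot separate \<open>y0\<close> from the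
      regular point \<open>y\<close>.\<close>
    have "b y0 = b y" if b: "b \<in> B" for b
    proof -
      obtain k where k: "k \<in> A" "T k = b" using T_surj[OF b] by blast
      have kw: "(\<lambda>x. k x * w x) \<in> A" using k(1) w(1) by (rule in_A_mult)
      have "T (\<lambda>x. k x * w x * u x) = T k"
      proof (rule T_eq[OF uA[OF kw] k(1)])
        show "T (\<lambda>x. k x * w x * u x) z = T k z" if z: "z \<in> regular_points" for z
          using Tu[OF kw z] regular_pointsD[OF z k(1)] by (simp add: wh[OF z])
      qed
      then have "b y0 = k x * w x" using bspec[OF x kw] by (simp add: \<xi>[OF kw] k(2))
      also have "\<dots> = b y" using regular_pointsD[OF y(1) k(1)] wh[OF y(1)] y(2) k(2) by simp
      finally show ?thesis .
    qed
    then have "y0 = y" using B_separates by blast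
    with y(1) show ?thesis by simp
  qed
  then show ?thesis by blast
qed

section \<open>Weighted composition form and injectivity of \<open>h\<close>\<close>

lemma T_weighted_composition: "f \<in> A \<Longrightarrow> T f y = T (\<lambda>x. 1) y * f (h y)"
  using regular_pointsD[of y] regular_points_UNIV by simp

lemma T_eq_0_iff: "f \<in> A \<Longrightarrow> T f y = 0 \<longleftrightarrow> f (h y) = 0"
proof -
  assume f: "f \<in> A"
  obtain k where "k \<in> A" "T k y = 1" using T_nonzero by blast
  then have "T (\<lambda>x. 1) y \<noteq> 0" using T_weighted_composition[of k y] by auto
  then show ?thesis using T_weighted_composition[OF f, of y] by simp
qed

text \<open>From \<open>T u = 1\<close>, the weight at \<open>y\<close> is the reciprocal of
  \<open>u (h y)\<close>. So every function in \<open>B\<close> factors through \<open>h\<close>,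
  and \<open>B\<close> separates points.\<close>

lemma h_inj: "inj h"
proof (rule injI, rule ccontr)
  fix y z assume eq: "h y = h z" and "y \<noteq> z"
  then obtain b where b: "b \<in> B" "b y \<noteq> b z" using B_separates by blast
  obtain k where k: "k \<in> A" "T k = b" using T_surj[OF b(1)] by blast
  obtain u where u: "u \<in> A" "T u = (\<lambda>y. 1)" using T_surj[OF B_const] by blast
  have "T (\<lambda>x. 1) y * u (h y) = T (\<lambda>x. 1) z * u (h y)"
    using T_weighted_composition[OF u(1), of y] T_weighted_composition[OF u(1), of z] u(2) eq by simp
  moreover have "u (h y) \<noteq> 0" using T_eq_0_iff[OF u(1), of y] u(2) by simp
  ultimately have "T (\<lambda>x. 1) y = T (\<lambda>x. 1) z" by simp
  then have "T k y = T k z"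
    using T_weighted_composition[OF k(1), of y] T_weighted_composition[OF k(1), of z] eq by simp
  with b(2) k(2) show False by simp
qed

end

section \<open>Inverse maps and joint biseparation\<close>

lemma inv_into_complex_linear_map:
  assumes lin: "complex_linear_map A B T" and bij: "bij_betw T A B" and A: "function_algebra A"
  shows "complex_linear_map B A (inv_into A T)"
proof -
  have inv: "inv_into A T b \<in> A" "T (inv_into A T b) = b" if "b \<in> B" for b
    using that bij by (auto simp: bij_betw_def inv_into_into f_inv_into_f)
  have eqI: "inv_into A T b = f" if "f \<in> A" "T f = b" for b f
    using that bij by (auto simp: bij_betw_def)
  have add: "(\<lambda>x. f x + g x) \<in> A" if "f \<in> A" "g \<in> A" for f g
    using A that unfolding function_algebra_def by simp
  have cmult: "(\<lambda>x. c * f x) \<in> A" if "f \<in> A" for f c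
    using A that unfolding function_algebra_def by simp
  show ?thesis
    unfolding complex_linear_map_def
  proof (intro conjI ballI allI)
    fix b assume b: "b \<in> B"
    show "inv_into A T b \<in> A" using inv b by blast
    show "inv_into A T (\<lambda>y. c * b y) = (\<lambda>x. c * inv_into A T b x)" for c
      by (rule eqI) (simp_all add: cmult inv b complex_linear_map_cmult[OF lin])
    fix b' assume b': "b' \<in> B"
    show "inv_into A T (\<lambda>y. b y + b' y) = (\<lambda>x. inv_into A T b x + inv_into A T b' x)"
      by (rule eqI) (simp_all add: add inv b b' complex_linear_map_add[OF lin])
  qed
qed

theorem corollary5p3:
  fixes A :: "('a::t2_space \<Rightarrow> complex) set"
    and B :: "('b::t2_space \<Rightarrow> complex) set"
    and NA :: "('a \<Rightarrow> complex) \<Rightarrow> real"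
    and NB :: "('b \<Rightarrow> complex) \<Rightarrow> real"
    and T S :: "('a \<Rightarrow> complex) \<Rightarrow> ('b \<Rightarrow> complex)"
  assumes "compact (UNIV :: 'a set)" and "compact (UNIV :: 'b set)"
    and "banach_function_algebra A NA" and "regular_algebra A" and "property_P A NA"
    and "banach_function_algebra B NB"
    and "jointly_separating A B T S"
    and "bij_betw T A B" and "bij_betw S A B"
  shows "(UNIV :: 'a set) homeomorphic (UNIV :: 'b set) \<and>
         jointly_separating B A (inv_into A T) (inv_into A S)"
proof -
  interpret regular_compact_banach_function_algebra A NA
    by unfold_locales (use assms in auto)
  have B: "function_algebra B" and A: "function_algebra A"
    using assms(3,6) by (auto simp: banach_function_algebra_def)
  have linT: "complex_linear_map A B T" and linS: "complex_linear_map A B S"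
    and sep: "\<And>f g. f \<in> A \<Longrightarrow> g \<in> A \<Longrightarrow> coz f \<inter> coz g = {} \<Longrightarrow> coz (T f) \<inter> coz (S g) = {}"
    using assms(7) by (auto simp: jointly_separating_def)
  \<comment> \<open>Preimages of the constant \<open>1\<close> show that the functionals at each
    \<open>y\<close> are nonzero, so their supports are nonempty.\<close>
  have "(\<lambda>y. 1) \<in> B" using B by (auto simp: function_algebra_def)
  then have "(\<lambda>y. 1) \<in> T ` A" "(\<lambda>y. 1) \<in> S ` A"
    using assms(8,9) by (simp_all add: bij_betw_imp_surj_on)
  then obtain u v where uv: "u \<in> A" "T u = (\<lambda>y. 1)" "v \<in> A" "S v = (\<lambda>y. 1)"
    by (elim imageE) metis
  have "\<exists>x. \<forall>f\<in>A. (\<exists>U. open U \<and> x \<in> U \<and> (\<forall>z\<in>U. f z = 0)) \<longrightarrow> T f y = 0 \<and> S f y = 0" for y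
  proof (rule common_support_point[where \<phi> = "\<lambda>f. T f y" and \<psi> = "\<lambda>f. S f y"])
    show "T u y \<noteq> 0" "S v y \<noteq> 0" using uv by simp_all
    show "T f y = 0 \<or> S g y = 0" if "f \<in> A" "g \<in> A" "coz f \<inter> coz g = {}" for f g
      using sep[OF that] by (auto simp: coz_def)
  qed (simp_all add: complex_linear_map_add[OF linT] complex_linear_map_add[OF linS] uv)
  then have "\<forall>y. \<exists>x. \<forall>f\<in>A. (\<exists>U. open U \<and> x \<in> U \<and> (\<forall>z\<in>U. f z = 0)) \<longrightarrow> T f y = 0 \<and> S f y = 0"
    by (rule allI)
  from choice[OF this] obtain h where
    h: "\<forall>y. \<forall>f\<in>A. (\<exists>U. open U \<and> h y \<in> U \<and> (\<forall>z\<in>U. f z = 0)) \<longrightarrow> T f y = 0 \<and> S f y = 0"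
    by (rule exE)
  \<comment> \<open>Joint separation is now encoded in the single \<open>h\<close> shared by both
    interpretations.\<close>
  interpret T: local_bijection A NA B T h
    by unfold_locales (use assms(2,5,8) B linT h in \<open>simp_all\<close>, blast)
  interpret S: local_bijection A NA B S h
    by unfold_locales (use assms(2,5,9) B linS h in \<open>simp_all\<close>, blast)
  have "(UNIV :: 'b set) homeomorphic (UNIV :: 'a set)"
    using assms(2) T.h_continuous T.h_surj T.h_inj by (rule homeomorphic_compact)
  moreover have "coz (inv_into A T b) \<inter> coz (inv_into A S c) = {}"
    if bc: "b \<in> B" "c \<in> B" "coz b \<inter> coz c = {}" for b c
  proof -
    have f: "inv_into A T b \<in> A" "T (inv_into A T b) = b"
      using bc(1) assms(8) by (auto simp: bij_betw_def inv_into_into f_inv_into_f)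
    have g: "inv_into A S c \<in> A" "S (inv_into A S c) = c"
      using bc(2) assms(9) by (auto simp: bij_betw_def inv_into_into f_inv_into_f)
    \<comment> \<open>The preimages vanish at \<open>h y\<close> exactly when \<open>b\<close> and
      \<open>c\<close> vanish at \<open>y\<close>, with the same \<open>h\<close> for both;
      surjectivity of \<open>h\<close> then covers \<open>X\<close>.\<close>
    have "inv_into A T b (h y) = 0 \<or> inv_into A S c (h y) = 0" for y
      using T.T_eq_0_iff[OF f(1), of y] S.T_eq_0_iff[OF g(1), of y] f(2) g(2) bc(3)
      by (auto simp: coz_def)
    then have "inv_into A T b x = 0 \<or> inv_into A S c x = 0" for x
      using T.h_surj by (metis UNIV_I imageE)
    then show ?thesis by (auto simp: coz_def)
  qed
  ultimately show ?thesis
    unfolding jointly_separating_def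
    using inv_into_complex_linear_map[OF linT assms(8) A] inv_into_complex_linear_map[OF linS assms(9) A]
    by (intro conjI ballI impI) (simp_all only: homeomorphic_sym[of "UNIV :: 'a set"])
qed

end
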